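(* A single SLIP measure is enough to provide necessary and sufficient conditions for any two generic pure $n$-qubit states to be SLOCC-equivalent.
   Context: A SLIP measure ($\mathrm{SL}$-invariant polynomial measure) of degree $h$ for $m$ qubits, denoted $\mathrm{SLIP}_m^h$, is an entanglement measure $E$ on pure $m$-qubit states (a function vanishing on separable states) that is a homogeneous polynomial of degree $h$ in the coefficients of the state (possibly up to taking the absolute value of such a polynomial) and is invariant under every $\mathcal O_1\otimes\cdots\otimes\mathcal O_m$ with $\mathcal O_i\in\mathrm{SL}(2,\mathbb C)$. Two pure $n$-qubit states $|\psi\rangle,|\phi\rangle$ are SLOCC-equivalent if $\mathcal O|\psi\rangle\propto|\phi\rangle$ for some $\mathcal O=\mathcal O_1\otimes\cdots\otimes\mathcal O_n$ with all $\mathcal O_i\in\mathrm{SL}(2,\mathbb C)$. "Generic" refers to all pure states except a subset of measure zero with respect to the Haar (Fubini–Study) measure, the unique unitarily invariant probability measure on pure states. How a measure provides conditions: one uses a measure $E$ of degree $h\ge3$ on $n-1$ qubits. For each qubit $i$, write the $n$-qubit state as $|\psi\rangle=|0\rangle_i|\psi_0\rangle+|1\rangle_i|\psi_1\rangle$, with $|\psi_0\rangle,|\psi_1\rangle$ unnormalized vectors of the other $n-1$ qubits; the roots for the $i$-th subsystem are the roots $z\in\mathbb C\cup\{\infty\}$ of $E(z|\psi_0\rangle+|\psi_1\rangle)$. If for some subsystem the two states have different numbers of roots, they are not SLOCC-equivalent. Otherwise, for each $i$ one determines all Möbius transformations carrying the $i$-th roots of the first state to the $i$-th roots of the second, takes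 the corresponding local operators $\mathcal O_i$, and forms all tensor products $\mathcal O_1\otimes\cdots\otimes\mathcal O_n$; the states are tested for being interconnected, up to normalization, by one of these operators. Here an operator $\begin{pmatrix}a&b\\c&d\end{pmatrix}$ acting by $|0\rangle\mapsto a|0\rangle+b|1\rangle$, $|1\rangle\mapsto c|0\rangle+d|1\rangle$ corresponds to the transformation $z\mapsto\frac{dz-b}{-cz+a}$ of roots. *)

theory Defs
  imports "HOL-Analysis.Analysis"
begin

section \<open>Qubit states\<close>

text \<open>
  Qubits are labelled by the elements of a finite type \<open>'n\<close>. A basis vector of the state space
  is a bit string \<open>x :: 'n \<Rightarrow> 2\<close>; the bits are the elements \<open>0\<close> and \<open>1\<close> of the two-element
  type \<open>2\<close> (in which the numeral \<open>2\<close> denotes \<open>0\<close>).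
\<close>

type_synonym 'n state = "complex ^ ('n \<Rightarrow> 2)"

text \<open>Representatives of pure states are unit vectors, so each state is counted with all its phases.\<close>

definition pure_states :: "'n::finite state set" where
  "pure_states = sphere 0 1"

definition separable :: "'n::finite state \<Rightarrow> bool" where
  "separable \<psi> \<longleftrightarrow> (\<exists>v :: 'n \<Rightarrow> complex ^ 2. \<psi> = (\<chi> x. \<Prod>i\<in>UNIV. v i $ x i))"

text \<open>
  Rows of a local operator are the images of \<open>|0>\<close> and \<open>|1>\<close>: the matrix with first row
  \<open>(a, b)\<close> and second row \<open>(c, d)\<close> maps \<open>|0>\<close> to \<open>a|0> + b|1>\<close> and \<open>|1>\<close> to \<open>c|0> + d|1>\<close>.
  Hence the summation over the row indices below.
\<close>

definition local_op :: "('n::finite \<Rightarrow> complex ^ 2 ^ 2) \<Rightarrow> 'n state \<Rightarrow> 'n state" where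
  "local_op A \<psi> = (\<chi> y. \<Sum>x\<in>UNIV. (\<Prod>i\<in>UNIV. A i $ x i $ y i) * \<psi> $ x)"

definition SL2 :: "(complex ^ 2 ^ 2) set" where
  "SL2 = {A. det A = 1}"

definition proportional :: "'n::finite state \<Rightarrow> 'n state \<Rightarrow> bool" where
  "proportional \<psi> \<phi> \<longleftrightarrow> (\<exists>c. c \<noteq> 0 \<and> \<psi> = c *s \<phi>)"

definition slocc_equivalent :: "'n::finite state \<Rightarrow> 'n state \<Rightarrow> bool" where
  "slocc_equivalent \<psi> \<phi> \<longleftrightarrow> (\<exists>A. (\<forall>i. A i \<in> SL2) \<and> proportional (local_op A \<psi>) \<phi>)"


section \<open>SLIP measures\<close>

definition homogeneous_polynomial :: "nat \<Rightarrow> (complex ^ 'a::finite \<Rightarrow> complex) \<Rightarrow> bool" where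
  "homogeneous_polynomial h p \<longleftrightarrow>
     (\<exists>c :: ('a \<Rightarrow> nat) \<Rightarrow> complex. \<forall>v.
        p v = (\<Sum>\<alpha> | (\<Sum>k\<in>UNIV. \<alpha> k) = h. c \<alpha> * (\<Prod>k\<in>UNIV. (v $ k) ^ \<alpha> k)))"

text \<open>
  The zero polynomial has no degree and is excluded. Measures are defined on all vectors because
  they are evaluated at unnormalized ones.
\<close>

definition slip_measure :: "nat \<Rightarrow> ('m::finite state \<Rightarrow> complex) \<Rightarrow> bool" where
  "slip_measure h E \<longleftrightarrow>
     (\<exists>p. homogeneous_polynomial h p \<and> (E = p \<or> E = (\<lambda>\<psi>. of_real (cmod (p \<psi>))))) \<and>
     (\<exists>\<psi>. E \<psi> \<noteq> 0) \<and>
     (\<forall>\<psi>. separable \<psi> \<longrightarrow> E \<psi> = 0) \<and>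
     (\<forall>A \<psi>. (\<forall>i. A i \<in> SL2) \<longrightarrow> E (local_op A \<psi>) = E \<psi>)"


section \<open>Roots and Moebius transformations\<close>

text \<open>
  To evaluate a measure for qubits \<open>'m\<close> on the qubits of \<open>'n\<close> other than \<open>i\<close>, the latter are
  identified with the former by \<open>e i\<close>; for linearly ordered labels one can take the
  order-preserving identification.
\<close>

definition qubit_labelling :: "('n \<Rightarrow> 'm \<Rightarrow> 'n) \<Rightarrow> bool" where
  "qubit_labelling e \<longleftrightarrow> (\<forall>i. bij_betw (e i) UNIV (UNIV - {i}))"

text \<open>\<open>|\<psi>> = |0>\<^sub>i |component e i 0 \<psi>> + |1>\<^sub>i |component e i 1 \<psi>>\<close>\<close>

definition component :: "('n \<Rightarrow> 'm \<Rightarrow> 'n) \<Rightarrow> 'n \<Rightarrow> 2 \<Rightarrow> 'n::finite state \<Rightarrow> 'm::finite state" where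
  "component e i b \<psi> = (\<chi> x. \<psi> $ (\<lambda>j. if j = i then b else x (inv (e i) j)))"

text \<open>
  The Riemann sphere is \<open>complex option\<close> with \<open>None\<close> as the point at infinity. Infinity is a root
  of \<open>E (z \<psi>\<^sub>0 + \<psi>\<^sub>1)\<close>, as a polynomial of formal degree \<open>h\<close> in \<open>z\<close>, iff the coefficient of
  \<open>z ^ h\<close> vanishes; that coefficient is \<open>E \<psi>\<^sub>0\<close>. Roots are taken without multiplicity.
\<close>

definition roots ::
  "('m::finite state \<Rightarrow> complex) \<Rightarrow> ('n \<Rightarrow> 'm \<Rightarrow> 'n) \<Rightarrow> 'n \<Rightarrow> 'n::finite state \<Rightarrow> complex option set"
where
  "roots E e i \<psi> =
     {Some z | z. E (z *s component e i 0 \<psi> + component e i 1 \<psi>) = 0} \<union>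
     (if E (component e i 0 \<psi>) = 0 then {None} else {})"

definition moebius :: "complex ^ 2 ^ 2 \<Rightarrow> complex option \<Rightarrow> complex option" where
  "moebius A w =
     (let a = A $ 0 $ 0; b = A $ 0 $ 1; c = A $ 1 $ 0; d = A $ 1 $ 1 in
      case w of
        None \<Rightarrow> if c = 0 then None else Some (d / (- c))
      | Some z \<Rightarrow> if - c * z + a = 0 then None else Some ((d * z - b) / (- c * z + a)))"

text \<open>Each Moebius transformation is \<open>moebius A\<close> for exactly two \<open>A \<in> SL2\<close>, which differ in sign.\<close>

definition root_operators ::
  "('m::finite state \<Rightarrow> complex) \<Rightarrow> ('n \<Rightarrow> 'm \<Rightarrow> 'n) \<Rightarrow> 'n \<Rightarrow> 'n::finite state \<Rightarrow> 'n state
     \<Rightarrow> (complex ^ 2 ^ 2) set"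
where
  "root_operators E e i \<psi> \<phi> = {A \<in> SL2. moebius A ` roots E e i \<psi> = roots E e i \<phi>}"

definition root_criterion ::
  "('m::finite state \<Rightarrow> complex) \<Rightarrow> ('n \<Rightarrow> 'm \<Rightarrow> 'n) \<Rightarrow> 'n::finite state \<Rightarrow> 'n state \<Rightarrow> bool"
where
  "root_criterion E e \<psi> \<phi> \<longleftrightarrow>
     (\<forall>i. card (roots E e i \<psi>) = card (roots E e i \<phi>)) \<and>
     (\<exists>A. (\<forall>i. A i \<in> root_operators E e i \<psi> \<phi>) \<and> proportional (local_op A \<psi>) \<phi>)"


section \<open>The unitarily invariant probability measure on pure states\<close>

text \<open>
  The uniform distribution on the unit ball, projected radially onto the unit sphere. It is
  carried as a Borel measure on the whole space. On rays it induces the Fubini--Study measure.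
\<close>

definition fubini_study :: "(complex ^ 'a::finite) measure" where
  "fubini_study = distr (uniform_measure lborel (ball 0 1)) borel sgn"

lemma emeasure_unit_ball:
  "emeasure lborel (ball (0::'a::euclidean_space) 1) \<noteq> 0"
  "emeasure lborel (ball (0::'a::euclidean_space) 1) \<noteq> \<infinity>"
  by (simp_all add: emeasure_ball less_imp_neq[OF unit_ball_vol_pos, symmetric])

lemma measurable_sgn_euclidean [measurable]:
  "(sgn :: 'a::euclidean_space \<Rightarrow> 'a) \<in> borel_measurable borel"
  unfolding sgn_div_norm by measurable

lemma sets_fubini_study [simp, measurable_cong]: "sets fubini_study = sets borel"
  by (simp add: fubini_study_def)

lemma emeasure_fubini_study:
  fixes S :: "(complex ^ 'a::finite) set"
  assumes [measurable]: "S \<in> sets borel"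
  shows "emeasure fubini_study S =
    emeasure lborel (ball 0 1 \<inter> sgn -` S) / emeasure lborel (ball (0 :: complex ^ 'a) 1)"
proof -
  have "sgn -` S \<in> sets (borel :: (complex ^ 'a) measure)"
    using measurable_sets[OF measurable_sgn_euclidean assms] by simp
  then show ?thesis
    unfolding fubini_study_def by (subst emeasure_distr) (auto simp: measurable_sgn_euclidean)
qed

lemma emeasure_fubini_study_sphere:
  "emeasure (fubini_study :: (complex ^ 'a::finite) measure) (sphere 0 1) = 1"
proof -
  let ?B = "ball (0 :: complex ^ 'a) 1"
  have eq: "?B \<inter> sgn -` sphere 0 1 = ?B - {0}"
    by (auto simp: norm_sgn)
  have "emeasure lborel (?B - {0}) = emeasure lborel ?B"
    by (rule emeasure_Diff_null_set) auto
  then show ?thesis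
    using emeasure_unit_ball[where 'a = "complex ^ 'a"]
    by (simp add: emeasure_fubini_study eq ennreal_divide_self less_top)
qed

lemma nn_integral_lborel_shift:
  fixes c :: "'a::euclidean_space"
  assumes [measurable]: "f \<in> borel_measurable borel"
  shows "(\<integral>\<^sup>+x. f (x + c) \<partial>lborel) = (\<integral>\<^sup>+x. f x \<partial>lborel)"
proof -
  have "(\<integral>\<^sup>+x. f x \<partial>lborel) = (\<integral>\<^sup>+x. f x \<partial>distr lborel borel ((+) c))"
    by (simp add: lborel_distr_plus)
  also have "\<dots> = (\<integral>\<^sup>+x. f (x + c) \<partial>lborel)"
    by (subst nn_integral_distr) (simp_all add: add.commute)
  finally show ?thesis by simp
qed

lemma nn_integral_lborel_uminus:
  fixes f :: "'a::euclidean_space \<Rightarrow> ennreal"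
  assumes [measurable]: "f \<in> borel_measurable borel"
  shows "(\<integral>\<^sup>+x. f (- x) \<partial>lborel) = (\<integral>\<^sup>+x. f x \<partial>lborel)"
proof -
  have "lborel = distr lborel borel (uminus :: 'a \<Rightarrow> 'a)"
    by (subst lborel_affine[of "-1" 0]) (simp_all add: density_1)
  then have "(\<integral>\<^sup>+x. f x \<partial>lborel) = (\<integral>\<^sup>+x. f x \<partial>distr lborel borel (uminus :: 'a \<Rightarrow> 'a))"
    by simp
  also have "\<dots> = (\<integral>\<^sup>+x. f (- x) \<partial>lborel)"
    by (subst nn_integral_distr) simp_all
  finally show ?thesis by simp
qed

lemma emeasure_lborel_isometry:
  fixes f :: "'a::euclidean_space \<Rightarrow> 'a"
  assumes f: "linear f" "\<And>x. norm (f x) = norm x"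
    and B: "B \<in> sets borel"
  shows "emeasure lborel (f -` B) = emeasure lborel B"
proof -
  have inj: "inj f"
    using f by (metis linear_injective_0 norm_eq_zero)
  then have surj: "surj f"
    using f(1) linear_injective_imp_surjective by blast
  have [measurable]: "f \<in> borel_measurable borel"
    using f(1) by (simp add: borel_measurable_continuous_onI linear_continuous_on linear_linear)
  let ?A = "ball (0::'a) 1"
  have A: "f -` ?A = ?A" using f(2) by auto
  have [measurable]: "B \<in> sets borel" by (rule B)
  have vB: "f -` B \<in> sets borel"
    using measurable_sets[OF \<open>f \<in> borel_measurable borel\<close> B] by simp
  have vimage: "(\<integral>\<^sup>+x. indicator B (f x) \<partial>lborel) = emeasure lborel (f -` B)"
    using vB by (simp flip: indicator_vimage nn_integral_indicator)
  have [measurable]: "?A \<in> sets borel" by simp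
  have f_fst [measurable]: "(\<lambda>p. f (fst p)) \<in> borel_measurable (borel \<Otimes>\<^sub>M borel)"
    by (rule measurable_compose[OF measurable_fst]) fact
  have f_snd [measurable]: "(\<lambda>p. f (snd p)) \<in> borel_measurable (borel \<Otimes>\<^sub>M borel)"
    by (rule measurable_compose[OF measurable_snd]) fact
  let ?I = "\<lambda>x y. indicator ?A (f x) * indicator B (f x + y) :: ennreal"
  have "(\<integral>\<^sup>+x. \<integral>\<^sup>+y. ?I x y \<partial>lborel \<partial>lborel)
      = (\<integral>\<^sup>+x. indicator ?A (f x) * emeasure lborel B \<partial>lborel)"
    using nn_integral_lborel_shift[of "indicator B"]
    by (intro nn_integral_cong) (simp add: nn_integral_cmult add.commute[of "f _"])
  also have "\<dots> = emeasure lborel ?A * emeasure lborel B"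
  proof -
    have "(\<integral>\<^sup>+x. indicator ?A (f x) \<partial>lborel) = emeasure lborel ?A"
      using A by (simp flip: indicator_vimage nn_integral_indicator)
    moreover have "(\<lambda>x. indicator ?A (f x) :: ennreal) \<in> borel_measurable lborel"
      by measurable
    ultimately show ?thesis by (simp add: nn_integral_multc)
  qed
  finally have 1: "(\<integral>\<^sup>+x. \<integral>\<^sup>+y. ?I x y \<partial>lborel \<partial>lborel) = emeasure lborel ?A * emeasure lborel B" .
  have "(\<integral>\<^sup>+x. \<integral>\<^sup>+y. ?I x y \<partial>lborel \<partial>lborel) = (\<integral>\<^sup>+y. \<integral>\<^sup>+x. ?I x y \<partial>lborel \<partial>lborel)"
    by (rule lborel_pair.Fubini') (measurable)
  also have "\<dots> = (\<integral>\<^sup>+y. \<integral>\<^sup>+x. indicator ?A (f x - y) * indicator B (f x) \<partial>lborel \<partial>lborel)"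
  proof (rule nn_integral_cong)
    fix y
    obtain c where c: "y = f c" using surj by blast
    have "(\<integral>\<^sup>+x. ?I x y \<partial>lborel)
        = (\<integral>\<^sup>+x. indicator ?A (f (x + c) - y) * indicator B (f (x + c)) \<partial>lborel)"
      using f(1) by (simp add: c linear_add)
    also have "\<dots> = (\<integral>\<^sup>+x. indicator ?A (f x - y) * indicator B (f x) \<partial>lborel)"
      by (rule nn_integral_lborel_shift) measurable
    finally show "(\<integral>\<^sup>+x. ?I x y \<partial>lborel) = \<dots>" .
  qed
  also have "\<dots> = (\<integral>\<^sup>+x. \<integral>\<^sup>+y. indicator ?A (f x - y) * indicator B (f x) \<partial>lborel \<partial>lborel)"
    by (rule lborel_pair.Fubini') measurable
  also have "\<dots> = (\<integral>\<^sup>+x. emeasure lborel ?A * indicator B (f x) \<partial>lborel)"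
  proof (rule nn_integral_cong)
    fix x
    have "(\<integral>\<^sup>+y. indicator ?A (f x - y) \<partial>lborel) = (\<integral>\<^sup>+y. indicator ?A (y + f x) \<partial>lborel)"
      using nn_integral_lborel_uminus[of "\<lambda>y. indicator ?A (y + f x)"] by simp
    also have "\<dots> = emeasure lborel ?A"
      using nn_integral_lborel_shift[of "indicator ?A"] by simp
    finally show "(\<integral>\<^sup>+y. indicator ?A (f x - y) * indicator B (f x) \<partial>lborel)
        = emeasure lborel ?A * indicator B (f x)"
      by (simp add: nn_integral_multc)
  qed
  also have "\<dots> = emeasure lborel ?A * emeasure lborel (f -` B)"
    by (simp add: nn_integral_cmult vimage)
  finally have "emeasure lborel ?A * emeasure lborel B = emeasure lborel ?A * emeasure lborel (f -` B)"
    using 1 by simp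
  then show ?thesis
    using emeasure_unit_ball[where 'a = 'a] by (simp add: ennreal_mult_cancel_left)
qed

lemma fubini_study_unitarily_invariant:
  fixes U :: "complex ^ 'a::finite ^ 'a"
  assumes U: "\<And>\<psi>. norm (U *v \<psi>) = norm \<psi>"
  shows "distr fubini_study borel (\<lambda>\<psi>. U *v \<psi>) = fubini_study"
proof (rule measure_eqI)
  let ?f = "\<lambda>\<psi>. U *v \<psi>"
  have lin: "linear ?f"
    by (rule linearI)
      (simp_all add: vec_eq_iff matrix_vector_mult_def scaleR_sum_right distrib_left sum.distrib)
  have meas [measurable]: "?f \<in> borel_measurable borel"
    using lin by (simp add: borel_measurable_continuous_onI linear_continuous_on linear_linear)
  have sgn: "sgn (?f \<psi>) = ?f (sgn \<psi>)" for \<psi>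
    using lin U by (simp add: sgn_div_norm linear_scale)
  fix S assume "S \<in> sets (distr fubini_study borel ?f)"
  then have S: "S \<in> sets borel" by simp
  have vS: "?f -` S \<in> sets borel" using measurable_sets[OF meas S] by simp
  have "sgn -` S \<in> sets (borel :: (complex ^ 'a) measure)"
    using measurable_sets[OF measurable_sgn_euclidean S] by simp
  then have b: "ball 0 1 \<inter> sgn -` S \<in> sets borel" by auto
  have "ball 0 1 \<inter> sgn -` (?f -` S) = ?f -` (ball 0 1 \<inter> sgn -` S)"
    using U by (auto simp: sgn)
  then have "emeasure fubini_study (?f -` S) = emeasure fubini_study S"
    using emeasure_lborel_isometry[OF lin U b] by (simp add: emeasure_fubini_study S vS)
  then show "emeasure (distr fubini_study borel ?f) S = emeasure fubini_study S"
    using S by (subst emeasure_distr) (simp_all add: sets_eq_imp_space_eq[OF sets_fubini_study])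
qed simp

end

theory Submission
  imports Defs "HOL-Computational_Algebra.Fundamental_Theorem_Algebra"
begin

text \<open>
  Any homogeneous \<open>SL\<close>-invariant polynomial \<open>E\<close> works in the equivalence: a local operator maps
  the components of \<open>\<psi>\<close> for qubit \<open>i\<close> to linear combinations of each other, so it carries the
  \<open>i\<close>-th roots along by the corresponding Moebius transformation, for every state. Genericity is
  needed only for the finiteness of the candidate operators. A Moebius transformation is determined
  by the images of three points, so it is enough that the \<open>i\<close>-th roots of a generic state are
  finite in number and at least three.

  The invariant is of degree \<open>4\<close>: four copies of the state are contracted at each qubit with the
  antisymmetric tensor \<open>\<epsilon>\<close>, pairing the copies as \<open>(12)(34)\<close> at two chosen qubits and as
  \<open>(13)(24)\<close> at all others. For three qubits this is Cayley's hyperdeterminant up to a factor. On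
  a suitable four-dimensional subspace it is \<open>-8xyzv\<close>, so that some pencil of states gives
  \<open>-8(t^4 - 1)\<close>. Hence the discriminant of \<open>E(z \<psi>\<^sub>0 + \<psi>\<^sub>1)\<close> is a nonzero homogeneous polynomial
  in \<open>\<psi>\<close>, and its zero set is null.
\<close>

section \<open>A quartic invariant\<close>

lemma bit_two: "(2 :: 2) = 0"
  by simp

lemma bit_exhaust: "(b :: 2) = 0 \<or> b = 1"
  using exhaust_2[of b] by auto

lemma sum_bit: "(\<Sum>b\<in>(UNIV :: 2 set). f b) = f 0 + f 1"
  by (simp add: sum_2 bit_two add.commute)

lemma det_bit: "det (A :: complex ^ 2 ^ 2) = A $ 0 $ 0 * A $ 1 $ 1 - A $ 0 $ 1 * A $ 1 $ 0"
  using det_2[of A] by (simp add: bit_two mult.commute)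

text \<open>Distributivity: a sum over bit strings of a product over sites factors into one sum per
  site, which reduces contractions to a single qubit.\<close>

lemma sum_fun_prod:
  fixes f :: "'m::finite \<Rightarrow> 'b::finite \<Rightarrow> 'c::comm_semiring_1"
  shows "(\<Sum>y\<in>UNIV. \<Prod>i\<in>UNIV. f i (y i)) = (\<Prod>i\<in>UNIV. \<Sum>b\<in>UNIV. f i b)"
  using prod_sum_PiE[of "UNIV :: 'm set" "\<lambda>_. UNIV" f] by (simp add: PiE_UNIV_domain)

lemma sum_prod4:
  "(\<Sum>(a, b, c, d)\<in>UNIV. f a b c d) = (\<Sum>a\<in>UNIV. \<Sum>b\<in>UNIV. \<Sum>c\<in>UNIV. \<Sum>d\<in>UNIV. f a b c d)"
  by (simp add: sum.cartesian_product)

definition eps :: "2 \<Rightarrow> 2 \<Rightarrow> complex" where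
  "eps a b = (if a = b then 0 else if a = 0 then 1 else - 1)"

lemma eps_simps [simp]: "eps a a = 0" "eps 0 1 = 1" "eps 1 0 = - 1"
  by (simp_all add: eps_def)

definition site_weight :: "bool \<Rightarrow> 2 \<Rightarrow> 2 \<Rightarrow> 2 \<Rightarrow> 2 \<Rightarrow> complex" where
  "site_weight r a b c d = (if r then eps a b * eps c d else eps a c * eps b d)"

definition weight :: "'m::finite set \<Rightarrow> ('m \<Rightarrow> 2) \<Rightarrow> ('m \<Rightarrow> 2) \<Rightarrow> ('m \<Rightarrow> 2) \<Rightarrow> ('m \<Rightarrow> 2) \<Rightarrow> complex" where
  "weight P a b c d = (\<Prod>i\<in>UNIV. site_weight (i \<in> P) (a i) (b i) (c i) (d i))"

text \<open>Four independent arguments, linear in each, instead of one state: multilinear expansion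
  then yields the coefficients along a pencil.\<close>

definition quad_form :: "'m::finite set \<Rightarrow> 'm state \<Rightarrow> 'm state \<Rightarrow> 'm state \<Rightarrow> 'm state \<Rightarrow> complex" where
  "quad_form P \<alpha> \<beta> \<gamma> \<delta> =
     (\<Sum>(a, b, c, d)\<in>UNIV. weight P a b c d * (\<alpha> $ a * \<beta> $ b * \<gamma> $ c * \<delta> $ d))"

definition quartic :: "'m::finite set \<Rightarrow> 'm state \<Rightarrow> complex" where
  "quartic P \<psi> = quad_form P \<psi> \<psi> \<psi> \<psi>"

text \<open>Contracting two rows of \<open>A\<close> with \<open>eps\<close> gives a 2 by 2 minor.
  As the determinant is 1, this is \<open>eps\<close> of the row indices again, for either
  pairing.\<close>

lemma site_weight_invariant:
  assumes "A \<in> SL2"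
  shows "(\<Sum>(a, b, c, d)\<in>UNIV. site_weight r a b c d * (A $ x $ a * A $ y $ b * A $ z $ c * A $ u $ d))
    = site_weight r x y z u"
proof -
  have eps: "A $ x $ 0 * A $ y $ 1 - A $ x $ 1 * A $ y $ 0 = eps x y" for x y
    using assms bit_exhaust[of x] bit_exhaust[of y] by (auto simp: SL2_def det_bit algebra_simps)
  have rhs: "site_weight r x y z u =
      (if r then (A $ x $ 0 * A $ y $ 1 - A $ x $ 1 * A $ y $ 0) * (A $ z $ 0 * A $ u $ 1 - A $ z $ 1 * A $ u $ 0)
       else (A $ x $ 0 * A $ z $ 1 - A $ x $ 1 * A $ z $ 0) * (A $ y $ 0 * A $ u $ 1 - A $ y $ 1 * A $ u $ 0))"
    by (simp add: site_weight_def eps)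
  show ?thesis
    unfolding sum_prod4 sum_bit rhs
    by (simp add: site_weight_def algebra_simps)
qed

lemma prod4_sum:
  fixes f g h k :: "'a::finite \<Rightarrow> complex"
  shows "(\<Sum>x\<in>UNIV. f x) * (\<Sum>x\<in>UNIV. g x) * (\<Sum>x\<in>UNIV. h x) * (\<Sum>x\<in>UNIV. k x)
    = (\<Sum>(x, y, z, u)\<in>UNIV. f x * g y * h z * k u)"
  by (simp only: sum_prod4 sum_distrib_left[symmetric] sum_distrib_right[symmetric])

lemma sum_fun_prod4:
  fixes f :: "'m::finite \<Rightarrow> 'b::finite \<Rightarrow> 'b \<Rightarrow> 'b \<Rightarrow> 'b \<Rightarrow> complex"
  shows "(\<Sum>(a, b, c, d)\<in>UNIV. \<Prod>i\<in>UNIV. f i (a i) (b i) (c i) (d i))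
    = (\<Prod>i\<in>UNIV. \<Sum>(a, b, c, d)\<in>UNIV. f i a b c d)"
proof -
  have "(\<Sum>d\<in>UNIV. \<Prod>i\<in>UNIV. f i (a i) (b i) (c i) (d i)) = (\<Prod>i\<in>UNIV. \<Sum>d\<in>UNIV. f i (a i) (b i) (c i) d)"
    for a b c by (rule sum_fun_prod)
  moreover have "(\<Sum>c\<in>UNIV. \<Prod>i\<in>UNIV. \<Sum>d\<in>UNIV. f i (a i) (b i) (c i) d)
      = (\<Prod>i\<in>UNIV. \<Sum>c\<in>UNIV. \<Sum>d\<in>UNIV. f i (a i) (b i) c d)" for a b
    by (rule sum_fun_prod)
  moreover have "(\<Sum>b\<in>UNIV. \<Prod>i\<in>UNIV. \<Sum>c\<in>UNIV. \<Sum>d\<in>UNIV. f i (a i) (b i) c d)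
      = (\<Prod>i\<in>UNIV. \<Sum>b\<in>UNIV. \<Sum>c\<in>UNIV. \<Sum>d\<in>UNIV. f i (a i) b c d)" for a
    by (rule sum_fun_prod)
  moreover have "(\<Sum>a\<in>UNIV. \<Prod>i\<in>UNIV. \<Sum>b\<in>UNIV. \<Sum>c\<in>UNIV. \<Sum>d\<in>UNIV. f i (a i) b c d)
      = (\<Prod>i\<in>UNIV. \<Sum>a\<in>UNIV. \<Sum>b\<in>UNIV. \<Sum>c\<in>UNIV. \<Sum>d\<in>UNIV. f i a b c d)"
    by (rule sum_fun_prod)
  ultimately show ?thesis
    unfolding sum_prod4 by (simp only:)
qed

lemma quad_form_local_op:
  fixes P :: "'m::finite set"
  assumes A: "\<And>i. A i \<in> SL2"
  shows "quad_form P (local_op A \<alpha>) (local_op A \<beta>) (local_op A \<gamma>) (local_op A \<delta>) = quad_form P \<alpha> \<beta> \<gamma> \<delta>"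
proof -
  define K where "K x a = (\<Prod>i\<in>UNIV. A i $ x i $ a i)" for x a :: "'m \<Rightarrow> 2"
  \<comment> \<open>The tensor \<open>weight P\<close> is a product over sites, so its invariance
    follows site by site. Interchanging the sums below then removes \<open>A\<close>.\<close>
  have W: "(\<Sum>(a, b, c, d)\<in>UNIV. weight P a b c d * (K x a * K y b * K z c * K u d)) = weight P x y z u"
    for x y z u
    using sum_fun_prod4[of "\<lambda>i a b c d. site_weight (i \<in> P) a b c d
        * (A i $ x i $ a * A i $ y i $ b * A i $ z i $ c * A i $ u i $ d)"] A
    by (simp add: weight_def K_def prod.distrib[symmetric] site_weight_invariant)
  have "quad_form P (local_op A \<alpha>) (local_op A \<beta>) (local_op A \<gamma>) (local_op A \<delta>)
    = (\<Sum>(a, b, c, d)\<in>UNIV. weight P a b c d * (\<Sum>(x, y, z, u)\<in>UNIV.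
        K x a * \<alpha> $ x * (K y b * \<beta> $ y) * (K z c * \<gamma> $ z) * (K u d * \<delta> $ u)))"
    by (simp add: quad_form_def local_op_def prod4_sum K_def)
  also have "\<dots> = (\<Sum>(a, b, c, d)\<in>UNIV. \<Sum>(x, y, z, u)\<in>UNIV. weight P a b c d *
        (K x a * K y b * K z c * K u d) * (\<alpha> $ x * \<beta> $ y * \<gamma> $ z * \<delta> $ u))"
    by (simp add: sum_distrib_left split_def mult_ac)
  also have "\<dots> = (\<Sum>(x, y, z, u)\<in>UNIV. \<Sum>(a, b, c, d)\<in>UNIV. weight P a b c d *
        (K x a * K y b * K z c * K u d) * (\<alpha> $ x * \<beta> $ y * \<gamma> $ z * \<delta> $ u))"
    unfolding split_def by (rule sum.swap)
  also have "\<dots> = (\<Sum>(x, y, z, u)\<in>UNIV. (\<Sum>(a, b, c, d)\<in>UNIV. weight P a b c d *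
        (K x a * K y b * K z c * K u d)) * (\<alpha> $ x * \<beta> $ y * \<gamma> $ z * \<delta> $ u))"
    by (simp add: sum_distrib_right split_def)
  also have "\<dots> = quad_form P \<alpha> \<beta> \<gamma> \<delta>"
    by (simp only: W quad_form_def)
  finally show ?thesis .
qed

lemma quartic_local_op:
  assumes "\<And>i. A i \<in> SL2"
  shows "quartic P (local_op A \<psi>) = quartic P \<psi>"
  using assms by (simp add: quartic_def quad_form_local_op)

lemma quad_form_add:
  "quad_form P (\<alpha> + \<alpha>') \<beta> \<gamma> \<delta> = quad_form P \<alpha> \<beta> \<gamma> \<delta> + quad_form P \<alpha>' \<beta> \<gamma> \<delta>"
  "quad_form P \<alpha> (\<beta> + \<beta>') \<gamma> \<delta> = quad_form P \<alpha> \<beta> \<gamma> \<delta> + quad_form P \<alpha> \<beta>' \<gamma> \<delta>"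
  "quad_form P \<alpha> \<beta> (\<gamma> + \<gamma>') \<delta> = quad_form P \<alpha> \<beta> \<gamma> \<delta> + quad_form P \<alpha> \<beta> \<gamma>' \<delta>"
  "quad_form P \<alpha> \<beta> \<gamma> (\<delta> + \<delta>') = quad_form P \<alpha> \<beta> \<gamma> \<delta> + quad_form P \<alpha> \<beta> \<gamma> \<delta>'"
  by (simp_all add: quad_form_def split_def algebra_simps sum.distrib)

lemma quad_form_scale:
  "quad_form P (t *s \<alpha>) \<beta> \<gamma> \<delta> = t * quad_form P \<alpha> \<beta> \<gamma> \<delta>"
  "quad_form P \<alpha> (t *s \<beta>) \<gamma> \<delta> = t * quad_form P \<alpha> \<beta> \<gamma> \<delta>"
  "quad_form P \<alpha> \<beta> (t *s \<gamma>) \<delta> = t * quad_form P \<alpha> \<beta> \<gamma> \<delta>"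
  "quad_form P \<alpha> \<beta> \<gamma> (t *s \<delta>) = t * quad_form P \<alpha> \<beta> \<gamma> \<delta>"
  by (simp_all add: quad_form_def split_def algebra_simps sum_distrib_left)

lemma quartic_scale: "quartic P (t *s \<psi>) = t ^ 4 * quartic P \<psi>"
  by (simp add: quartic_def quad_form_scale power4_eq_xxxx mult.assoc)

text \<open>On a product state the contraction factors over the sites, and each factor contracts a
  vector with itself by the antisymmetric \<open>eps\<close>.\<close>

lemma quartic_separable:
  fixes P :: "'m::finite set"
  assumes "separable \<psi>"
  shows "quartic P \<psi> = 0"
proof -
  obtain v :: "'m \<Rightarrow> complex ^ 2" where v: "\<psi> = (\<chi> x. \<Prod>i\<in>UNIV. v i $ x i)"
    using assms by (auto simp: separable_def)
  have "quartic P \<psi> = (\<Prod>i\<in>UNIV. \<Sum>(a, b, c, d)\<in>UNIV. site_weight (i \<in> P) a b c d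
      * (v i $ a * v i $ b * v i $ c * v i $ d))"
    unfolding sum_fun_prod4[symmetric]
    by (simp add: quartic_def quad_form_def v weight_def prod.distrib)
  also have "\<dots> = (\<Prod>i\<in>(UNIV :: 'm set). 0)"
    unfolding sum_prod4 sum_bit site_weight_def
    by (intro prod.cong) (auto simp: algebra_simps)
  \<comment> \<open>The product of zeros is not an empty product, because a type has at least one
    element.\<close>
  also have "\<dots> = 0" by simp
  finally show ?thesis .
qed

section \<open>Homogeneous polynomials of fixed degree\<close>

lemma homogeneous_polynomial_monomial:
  assumes "(\<Sum>k\<in>UNIV. \<alpha>0 k) = h"
  shows "homogeneous_polynomial h (\<lambda>v :: complex ^ 'a::finite. \<Prod>k\<in>UNIV. (v $ k) ^ \<alpha>0 k)"
proof -
  \<comment> \<open>Each exponent is at most \<open>h\<close>. Finiteness lets the sum over all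
    exponent vectors pick out a single term.\<close>
  have "finite {\<alpha> :: 'a \<Rightarrow> nat. (\<Sum>k\<in>UNIV. \<alpha> k) = h}"
  proof (rule finite_subset)
    show "{\<alpha> :: 'a \<Rightarrow> nat. (\<Sum>k\<in>UNIV. \<alpha> k) = h} \<subseteq> UNIV \<rightarrow>\<^sub>E {..h}"
      by (auto simp: PiE_UNIV_domain intro: member_le_sum)
  qed (simp add: finite_PiE)
  then show ?thesis
    using assms unfolding homogeneous_polynomial_def
    by (intro exI[of _ "\<lambda>\<alpha>. if \<alpha> = \<alpha>0 then 1 else 0"]) (simp add: if_distrib[of "\<lambda>x. x * _"] sum.delta cong: if_cong)
qed

lemma homogeneous_polynomial_scale:
  "homogeneous_polynomial h p \<Longrightarrow> homogeneous_polynomial h (\<lambda>v. t * p v)"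
  unfolding homogeneous_polynomial_def
  by (elim exE, rule_tac x="\<lambda>\<alpha>. t * c \<alpha>" in exI) (simp add: sum_distrib_left mult.assoc)

lemma homogeneous_polynomial_add:
  "homogeneous_polynomial h p \<Longrightarrow> homogeneous_polynomial h q \<Longrightarrow> homogeneous_polynomial h (\<lambda>v. p v + q v)"
  unfolding homogeneous_polynomial_def
  by (elim exE, rule_tac x="\<lambda>\<alpha>. c \<alpha> + ca \<alpha>" in exI) (simp add: sum.distrib distrib_right)

lemma homogeneous_polynomial_sum:
  assumes "finite I" "\<And>i. i \<in> I \<Longrightarrow> homogeneous_polynomial h (p i)"
  shows "homogeneous_polynomial h (\<lambda>v. \<Sum>i\<in>I. p i v)"
  using assms
proof (induction I rule: finite_induct)
  case empty
  then show ?case by (auto simp: homogeneous_polynomial_def intro!: exI[of _ "\<lambda>_. 0"])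
qed (simp add: homogeneous_polynomial_add)

lemma homogeneous_polynomial_coordinates4:
  fixes a b c d :: "'a::finite"
  shows "homogeneous_polynomial 4 (\<lambda>v. v $ a * v $ b * v $ c * v $ d)"
proof -
  \<comment> \<open>Indices may coincide, so the exponent at \<open>k\<close> counts how often
    \<open>k\<close> occurs among the four.\<close>
  define \<alpha> where "\<alpha> k = of_bool (k = a) + of_bool (k = b) + of_bool (k = c) + (of_bool (k = d) :: nat)" for k
  have "(\<Sum>k\<in>UNIV. \<alpha> k) = 4"
    by (simp add: \<alpha>_def sum.distrib of_bool_def)
  moreover have "(\<Prod>k\<in>UNIV. (v $ k) ^ \<alpha> k) = v $ a * v $ b * v $ c * v $ d" for v :: "complex ^ 'a"
  proof -
    have "(\<Prod>k\<in>UNIV. (v $ k) ^ of_bool (k = a)) = v $ a" for a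
      by (simp add: of_bool_def if_distrib[of "power _"] prod.delta cong: if_cong)
    then show ?thesis by (simp add: \<alpha>_def power_add prod.distrib)
  qed
  ultimately show ?thesis
    using homogeneous_polynomial_monomial[of \<alpha> 4] by simp
qed

lemma homogeneous_polynomial_quartic: "homogeneous_polynomial 4 (quartic P)"
  unfolding quartic_def[abs_def] quad_form_def split_def
  by (intro homogeneous_polynomial_sum homogeneous_polynomial_scale homogeneous_polynomial_coordinates4) simp

text \<open>Only nonvanishing is left open, since two qubits and more than two qubits need different
  witnesses.\<close>

lemma slip_measure_quartic:
  assumes "\<exists>\<psi>. quartic P \<psi> \<noteq> 0"
  shows "slip_measure 4 (quartic P)"
  unfolding slip_measure_def
  using assms homogeneous_polynomial_quartic[of P] by (auto simp: quartic_local_op quartic_separable)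

section \<open>Local operators and roots\<close>

definition attach :: "('n \<Rightarrow> 'm \<Rightarrow> 'n) \<Rightarrow> 'n \<Rightarrow> 2 \<Rightarrow> ('m \<Rightarrow> 2) \<Rightarrow> 'n \<Rightarrow> 2" where
  "attach e i b x = (\<lambda>j. if j = i then b else x (inv (e i) j))"

lemma component_nth: "component e i b \<psi> $ x = \<psi> $ attach e i b x"
  by (simp add: component_def attach_def)

lemma attach_same [simp]: "attach e i b x i = b"
  by (simp add: attach_def)

lemma attach_other [simp]:
  assumes "qubit_labelling e"
  shows "attach e i b x (e i k) = x k"
proof -
  have "inj (e i)" "e i k \<noteq> i"
    using assms by (auto simp: qubit_labelling_def bij_betw_def)
  then show ?thesis by (simp add: attach_def)
qed

lemma attach_restrict:
  assumes "qubit_labelling e"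
  shows "attach e i (w i) (w \<circ> e i) = w"
proof
  fix j
  have "j \<noteq> i \<Longrightarrow> j \<in> range (e i)"
    using assms by (auto simp: qubit_labelling_def bij_betw_def)
  then show "attach e i (w i) (w \<circ> e i) j = w j"
    by (auto simp: attach_def f_inv_into_f)
qed

lemma bij_attach:
  assumes "qubit_labelling e"
  shows "bij_betw (\<lambda>(b, x). attach e i b x) UNIV UNIV"
  by (rule bij_betw_byWitness[where f' = "\<lambda>w. (w i, w \<circ> e i)"])
    (auto simp: attach_restrict[OF assms] attach_other[OF assms] fun_eq_iff)

lemma component_scale: "component e i b (t *s \<psi>) = t *s component e i b \<psi>"
  by (simp add: vec_eq_iff component_def)

lemma local_op_combination:
  "local_op A (s *s \<psi> + t *s \<phi>) = s *s local_op A \<psi> + t *s local_op A \<phi>"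
  by (simp add: vec_eq_iff local_op_def algebra_simps sum.distrib sum_distrib_left)

text \<open>Splitting the factor of qubit \<open>i\<close> off every matrix element leaves the
  operators on the other qubits. Rows of \<open>A i\<close> are images of basis vectors, so its
  column \<open>b\<close> supplies the coefficients.\<close>

lemma component_local_op:
  fixes e :: "'n::finite \<Rightarrow> 'm::finite \<Rightarrow> 'n"
  assumes e: "qubit_labelling e"
  shows "component e i b (local_op A \<psi>) =
    local_op (A \<circ> e i) (A i $ 0 $ b *s component e i 0 \<psi> + A i $ 1 $ b *s component e i 1 \<psi>)"
proof (rule vec_eq_iff[THEN iffD2, rule_format])
  fix y :: "'m \<Rightarrow> 2"
  have prod: "(\<Prod>j\<in>UNIV. A j $ attach e i a x j $ attach e i b y j)
      = A i $ a $ b * (\<Prod>k\<in>UNIV. A (e i k) $ x k $ y k)" for a x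
  proof -
    have "(\<Prod>j\<in>UNIV. A j $ attach e i a x j $ attach e i b y j)
      = A i $ a $ b * (\<Prod>j\<in>UNIV - {i}. A j $ attach e i a x j $ attach e i b y j)"
      by (subst prod.remove[of _ i]) auto
    also have "(\<Prod>j\<in>UNIV - {i}. A j $ attach e i a x j $ attach e i b y j)
      = (\<Prod>k\<in>UNIV. A (e i k) $ x k $ y k)"
      using e by (subst prod.reindex_bij_betw[symmetric, where h = "e i" and S = UNIV])
        (auto simp: qubit_labelling_def)
    finally show ?thesis .
  qed
  have "component e i b (local_op A \<psi>) $ y
    = (\<Sum>w\<in>UNIV. (\<Prod>j\<in>UNIV. A j $ w j $ attach e i b y j) * \<psi> $ w)"
    by (simp add: component_nth local_op_def)
  also have "\<dots> = (\<Sum>(a, x)\<in>UNIV. A i $ a $ b * (\<Prod>k\<in>UNIV. A (e i k) $ x k $ y k) * \<psi> $ attach e i a x)"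
    by (subst sum.reindex_bij_betw[OF bij_attach[OF e, of i], symmetric]) (simp add: split_def prod)
  also have "\<dots> = (\<Sum>a\<in>UNIV. \<Sum>x\<in>UNIV. A i $ a $ b * (\<Prod>k\<in>UNIV. A (e i k) $ x k $ y k) * \<psi> $ attach e i a x)"
    by (simp add: sum.cartesian_product)
  also have "\<dots> = local_op (A \<circ> e i) (A i $ 0 $ b *s component e i 0 \<psi> + A i $ 1 $ b *s component e i 1 \<psi>) $ y"
    by (simp add: sum_bit local_op_def component_nth algebra_simps sum.distrib)
  finally show "component e i b (local_op A \<psi>) $ y = \<dots>" .
qed

section \<open>Moebius transformations of the Riemann sphere\<close>

lemma det_SL2: "A \<in> SL2 \<Longrightarrow> A $ 0 $ 0 * A $ 1 $ 1 - A $ 0 $ 1 * A $ 1 $ 0 = 1"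
  by (simp add: SL2_def det_bit)

text \<open>Cross-multiplying two equal finite values leaves the determinant times
  \<open>z - z'\<close>. That the determinant is 1 also makes the pole unique and keeps the value at
  infinity from being taken elsewhere.\<close>

lemma inj_moebius:
  assumes "A \<in> SL2"
  shows "inj (moebius A)"
proof (rule injI)
  note det = det_SL2[OF assms]
  fix w w' assume eq: "moebius A w = moebius A w'"
  let ?a = "A $ 0 $ 0" and ?b = "A $ 0 $ 1" and ?c = "A $ 1 $ 0" and ?d = "A $ 1 $ 1"
  have pole: "z = z'" if "- ?c * z + ?a = 0" "- ?c * z' + ?a = 0" for z z'
  proof -
    have "z = z * (?a * ?d - ?b * ?c)" "z' = z' * (?a * ?d - ?b * ?c)" using det by simp_all
    moreover have "z * (?a * ?d - ?b * ?c) = z' * (?a * ?d - ?b * ?c)" using that by algebra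
    ultimately show ?thesis by simp
  qed
  have fin: "z = z'" if "- ?c * z + ?a \<noteq> 0" "- ?c * z' + ?a \<noteq> 0"
    "(?d * z - ?b) / (- ?c * z + ?a) = (?d * z' - ?b) / (- ?c * z' + ?a)" for z z'
  proof -
    have "(?d * z - ?b) * (- ?c * z' + ?a) = (?d * z' - ?b) * (- ?c * z + ?a)"
      using that by (simp add: frac_eq_eq)
    moreover have "(?d * z - ?b) * (- ?c * z' + ?a) - (?d * z' - ?b) * (- ?c * z + ?a)
        = (?a * ?d - ?b * ?c) * (z - z')"
      by (simp add: algebra_simps)
    ultimately have "(?a * ?d - ?b * ?c) * (z - z') = 0"
      by (metis right_minus_eq)
    then show ?thesis unfolding det by simp
  qed
  have inf: False if "?c \<noteq> 0" "- ?c * z + ?a \<noteq> 0" "(?d * z - ?b) / (- ?c * z + ?a) = ?d / (- ?c)" for z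
  proof -
    have "(?d * z - ?b) * (- ?c) = ?d * (- ?c * z + ?a)"
      using that frac_eq_eq[of "- ?c * z + ?a" "- ?c" "?d * z - ?b" ?d] by simp
    then show ?thesis using det by algebra
  qed
  have no_pole: "?c \<noteq> 0" if "- ?c * z + ?a = 0" for z
    using that det by auto
  show "w = w'"
  proof (cases w; cases w')
    fix z z' assume w: "w = Some z" "w' = Some z'"
    have "z = z'"
      using eq fin[of z z'] pole[of z z'] unfolding w moebius_def Let_def option.case
      by (metis option.distinct(1) option.inject)
    with w show ?thesis by simp
  next
    fix z assume "w = None" "w' = Some z"
    with eq inf[of z] no_pole[of z] show ?thesis by (auto simp: moebius_def Let_def split: if_splits)
  next
    fix z assume "w = Some z" "w' = None"
    with eq inf[of z] no_pole[of z] show ?thesis by (auto simp: moebius_def Let_def split: if_splits)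
  qed simp
qed

lemma surj_moebius:
  assumes "A \<in> SL2"
  shows "surj (moebius A)"
proof -
  note det = det_SL2[OF assms]
  let ?a = "A $ 0 $ 0" and ?b = "A $ 0 $ 1" and ?c = "A $ 1 $ 0" and ?d = "A $ 1 $ 1"
  have "\<exists>w. moebius A w = v" for v
  proof (cases v)
    case None
    show ?thesis
    proof (cases "?c = 0")
      case True then show ?thesis using None by (intro exI[of _ None]) (simp add: moebius_def)
    next
      case False then show ?thesis using None by (intro exI[of _ "Some (?a / ?c)"]) (simp add: moebius_def)
    qed
  next
    case (Some z)
    show ?thesis
    proof (cases "?c * z + ?d = 0")
      case True
      then have "?c \<noteq> 0" using det by auto
      moreover have "?d = - ?c * z" using True by algebra
      ultimately show ?thesis using Some by (intro exI[of _ None]) (simp add: moebius_def)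
    next
      case False
      \<comment> \<open>The inverse transformation of \<open>z\<close>.\<close>
      let ?w = "(?a * z + ?b) / (?c * z + ?d)"
      have "(- ?c * ?w + ?a) * (?c * z + ?d) = - ?c * (?a * z + ?b) + ?a * (?c * z + ?d)"
        using False by (simp add: field_simps)
      also have "\<dots> = 1" using det by algebra
      finally have 1: "- ?c * ?w + ?a = 1 / (?c * z + ?d)" using False by (simp add: eq_divide_eq)
      have "(?d * ?w - ?b) * (?c * z + ?d) = ?d * (?a * z + ?b) - ?b * (?c * z + ?d)"
        using False by (simp add: field_simps)
      also have "\<dots> = z" using det by algebra
      finally have 2: "?d * ?w - ?b = z / (?c * z + ?d)" using False by (simp add: eq_divide_eq)
      have "moebius A (Some ?w) = Some z"
        using False unfolding moebius_def Let_def option.case 1 2 by simp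
      then show ?thesis using Some by blast
    qed
  qed
  then show ?thesis by (metis surjI)
qed

text \<open>Roots on the projective line: \<open>z\<close> stands for \<open>(z : 1)\<close> and
  infinity for \<open>(1 : 0)\<close>, so that a homogeneous form treats them alike.\<close>

definition binary_form_roots :: "(complex \<Rightarrow> complex \<Rightarrow> complex) \<Rightarrow> complex option set" where
  "binary_form_roots F = {Some z | z. F z 1 = 0} \<union> (if F 1 0 = 0 then {None} else {})"

text \<open>A Moebius transformation of \<open>z = x / y\<close> is the inverse substitution in the form.\<close>

lemma moebius_binary_form_roots:
  assumes A: "A \<in> SL2" and "k \<noteq> 0"
    and hom: "\<And>t x y. G (t * x) (t * y) = t ^ h * G x y"
    and G: "\<And>x y. k * G x y = F (A $ 0 $ 0 * x + A $ 0 $ 1 * y) (A $ 1 $ 0 * x + A $ 1 $ 1 * y)"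
  shows "moebius A ` binary_form_roots F = binary_form_roots G"
proof -
  note det = det_SL2[OF A]
  let ?a = "A $ 0 $ 0" and ?b = "A $ 0 $ 1" and ?c = "A $ 1 $ 0" and ?d = "A $ 1 $ 1"
  have G0: "G (t * x) (t * y) = 0 \<longleftrightarrow> G x y = 0" if "t \<noteq> 0" for t x y
    using that by (simp add: hom)
  have fin: "G (?d * z - ?b) (- ?c * z + ?a) = 0 \<longleftrightarrow> F z 1 = 0" for z
  proof -
    \<comment> \<open>By the inverse matrix, \<open>(d z - b, - c z + a)\<close> is the point that
      the substitution sends to \<open>(z, 1)\<close>.\<close>
    have "?a * (?d * z - ?b) + ?b * (- ?c * z + ?a) = z" "?c * (?d * z - ?b) + ?d * (- ?c * z + ?a) = 1"
      using det by algebra+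
    then show ?thesis using G[of "?d * z - ?b" "- ?c * z + ?a"] \<open>k \<noteq> 0\<close> by (metis mult_eq_0_iff)
  qed
  have inf: "G ?d (- ?c) = 0 \<longleftrightarrow> F 1 0 = 0"
  proof -
    have "?a * ?d + ?b * - ?c = 1" "?c * ?d + ?d * - ?c = 0" using det by (simp_all add: mult.commute)
    then show ?thesis using G[of ?d "- ?c"] \<open>k \<noteq> 0\<close> by (metis mult_eq_0_iff)
  qed
  have quot: "G (p / q) 1 = 0 \<longleftrightarrow> G p q = 0" if "q \<noteq> 0" for p q
    using G0[of q "p / q" 1] that by simp
  have "moebius A w \<in> binary_form_roots G \<longleftrightarrow> w \<in> binary_form_roots F" for w
  proof (cases w)
    case None
    have "?c = 0 \<Longrightarrow> ?d \<noteq> 0" using det by auto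
    then show ?thesis
      using None G0[of ?d 1 0] inf quot[of "- ?c" ?d] det
      by (cases "?c = 0") (auto simp: binary_form_roots_def moebius_def)
  next
    case (Some z)
    show ?thesis
    proof (cases "- ?c * z + ?a = 0")
      case True
      \<comment> \<open>At the pole the image point is \<open>(d z - b : 0)\<close>, a nonzero
        multiple of \<open>(1, 0)\<close>.\<close>
      then have "?d * z - ?b \<noteq> 0" using det by algebra
      then show ?thesis using Some True G0[of "?d * z - ?b" 1 0] fin[of z]
        by (simp add: binary_form_roots_def moebius_def)
    next
      case False
      then show ?thesis using Some quot[OF False, of "?d * z - ?b"] fin[of z]
        by (simp add: binary_form_roots_def moebius_def)
    qed
  qed
  then show ?thesis using surj_moebius[OF A] by (metis (no_types, opaque_lifting) equalityI image_iff image_subsetI subsetI surjD)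
qed

lemma roots_eq_binary_form_roots:
  "roots E e i \<psi> = binary_form_roots (\<lambda>x y. E (x *s component e i 0 \<psi> + y *s component e i 1 \<psi>))"
  by (simp add: roots_def binary_form_roots_def)

text \<open>Invariance of \<open>E\<close> removes the operators on the other qubits, so along the
  \<open>i\<close>-th pencil only a linear substitution in the two coefficients remains. The scalar
  \<open>c\<close> contributes the nonzero factor \<open>c ^ h\<close>.\<close>

lemma moebius_roots:
  fixes e :: "'n::finite \<Rightarrow> 'm::finite \<Rightarrow> 'n"
  assumes e: "qubit_labelling e" and A: "\<And>i. A i \<in> SL2"
    and c: "c \<noteq> 0" "local_op A \<psi> = c *s \<phi>"
    and inv: "\<And>A \<psi>. (\<And>i. A i \<in> SL2) \<Longrightarrow> E (local_op A \<psi>) = E \<psi>"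
    and hom: "\<And>t \<psi>. E (t *s \<psi>) = t ^ h * E \<psi>"
  shows "moebius (A i) ` roots E e i \<psi> = roots E e i \<phi>"
  unfolding roots_eq_binary_form_roots
proof (rule moebius_binary_form_roots)
  show "A i \<in> SL2" by (rule A)
  show "c ^ h \<noteq> 0" using c by simp
  show "E (t * x *s component e i 0 \<phi> + t * y *s component e i 1 \<phi>)
      = t ^ h * E (x *s component e i 0 \<phi> + y *s component e i 1 \<phi>)" for t x y
    by (simp add: hom[symmetric] vector_add_ldistrib)
  fix x y
  have "c ^ h * E (x *s component e i 0 \<phi> + y *s component e i 1 \<phi>)
      = E (x *s component e i 0 (c *s \<phi>) + y *s component e i 1 (c *s \<phi>))"
    by (simp add: hom[symmetric] component_scale vector_add_ldistrib mult_ac)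
  also have "\<dots> = E (local_op (A \<circ> e i)
      (x *s (A i $ 0 $ 0 *s component e i 0 \<psi> + A i $ 1 $ 0 *s component e i 1 \<psi>)
      + y *s (A i $ 0 $ 1 *s component e i 0 \<psi> + A i $ 1 $ 1 *s component e i 1 \<psi>)))"
    by (simp only: c(2)[symmetric] component_local_op[OF e] local_op_combination)
  also have "\<dots> = E (x *s (A i $ 0 $ 0 *s component e i 0 \<psi> + A i $ 1 $ 0 *s component e i 1 \<psi>)
      + y *s (A i $ 0 $ 1 *s component e i 0 \<psi> + A i $ 1 $ 1 *s component e i 1 \<psi>))"
    by (rule inv) (simp add: A)
  also have "\<dots> = E ((A i $ 0 $ 0 * x + A i $ 0 $ 1 * y) *s component e i 0 \<psi>
      + (A i $ 1 $ 0 * x + A i $ 1 $ 1 * y) *s component e i 1 \<psi>)"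
    by (simp add: vec_eq_iff arg_cong[where f = E] algebra_simps)
  finally show "c ^ h * E (x *s component e i 0 \<phi> + y *s component e i 1 \<phi>) = \<dots>" .
qed

text \<open>By \<open>moebius_roots\<close> an operator relating the states is itself one of the
  candidates. Conversely, every candidate is a product of elements of \<open>SL2\<close>.\<close>

lemma slocc_equivalent_iff_root_criterion:
  fixes e :: "'n::finite \<Rightarrow> 'm::finite \<Rightarrow> 'n"
  assumes e: "qubit_labelling e"
    and inv: "\<And>A \<psi>. (\<And>i. A i \<in> SL2) \<Longrightarrow> E (local_op A \<psi>) = E \<psi>"
    and hom: "\<And>t \<psi>. E (t *s \<psi>) = t ^ h * E \<psi>"
  shows "slocc_equivalent \<psi> \<phi> \<longleftrightarrow> root_criterion E e \<psi> \<phi>"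
proof
  assume "slocc_equivalent \<psi> \<phi>"
  then obtain A c where A: "\<And>i. A i \<in> SL2" and c: "c \<noteq> 0" "local_op A \<psi> = c *s \<phi>"
    by (auto simp: slocc_equivalent_def proportional_def)
  have im: "moebius (A i) ` roots E e i \<psi> = roots E e i \<phi>" for i
    using moebius_roots[OF e A c inv hom] by simp
  \<comment> \<open>A form that vanishes identically has infinitely many roots; \<open>card\<close>
    is then 0 on both sides, which \<open>card_image\<close> covers.\<close>
  have "card (roots E e i \<psi>) = card (roots E e i \<phi>)" for i
    using card_image[OF inj_on_subset[OF inj_moebius[OF A[of i]] subset_UNIV]] im by metis
  then show "root_criterion E e \<psi> \<phi>"
    using A c im unfolding root_criterion_def root_operators_def proportional_def by blast
qed (auto simp: root_criterion_def root_operators_def slocc_equivalent_def)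

section \<open>Three points determine a Moebius transformation\<close>

lemma moebius_Some_eq_Some:
  "moebius A (Some z) = Some w \<Longrightarrow> A $ 1 $ 1 * z - A $ 0 $ 1 = w * (- A $ 1 $ 0 * z + A $ 0 $ 0)"
  by (auto simp: moebius_def Let_def split: if_splits)

text \<open>Eliminating the common value at \<open>z\<close> leaves a quadratic equation in
  \<open>z\<close>. Three distinct solutions force its coefficients \<open>p\<close>,
  \<open>q\<close>, \<open>r\<close> to vanish, which makes \<open>B\<close> a multiple of
  \<open>A\<close>; the determinants fix the factor up to sign.\<close>

lemma moebius_eq_cases:
  assumes A: "A \<in> SL2" and B: "B \<in> SL2"
    and z: "z1 \<noteq> z2" "z1 \<noteq> z3" "z2 \<noteq> z3"
    and eq: "\<And>z. z \<in> {z1, z2, z3} \<Longrightarrow> \<exists>w. moebius A (Some z) = Some w \<and> moebius B (Some z) = Some w"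
  shows "B = A \<or> B = - A"
proof -
  note det = det_SL2[OF A] and det' = det_SL2[OF B]
  let ?a = "A $ 0 $ 0" and ?b = "A $ 0 $ 1" and ?c = "A $ 1 $ 0" and ?d = "A $ 1 $ 1"
  let ?a' = "B $ 0 $ 0" and ?b' = "B $ 0 $ 1" and ?c' = "B $ 1 $ 0" and ?d' = "B $ 1 $ 1"
  define p q r where "p = - ?d * ?c' + ?d' * ?c" and "q = ?d * ?a' + ?b * ?c' - ?d' * ?a - ?b' * ?c"
    and "r = ?b' * ?a - ?b * ?a'"
  have zero: "p * z\<^sup>2 + q * z + r = 0" if z: "z \<in> {z1, z2, z3}" for z
  proof -
    obtain w where "moebius A (Some z) = Some w" "moebius B (Some z) = Some w" using eq[OF z] by blast
    then have "(?d * z - ?b) = w * (- ?c * z + ?a)" "(?d' * z - ?b') = w * (- ?c' * z + ?a')"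
      by (simp_all only: moebius_Some_eq_Some)
    then show ?thesis unfolding p_def q_def r_def by algebra
  qed
  have "p * (z1 - z2) * (z1 - z3) * (z2 - z3) = 0"
    using zero[of z1] zero[of z2] zero[of z3] by simp algebra
  then have p: "p = 0" using z by simp
  have "q * (z1 - z2) = 0" using zero[of z1] zero[of z2] p by simp algebra
  then have q: "q = 0" using z by simp
  have r: "r = 0" using zero[of z1] p q by simp
  \<comment> \<open>\<open>l\<close> is the upper left entry of \<open>B\<close> times the inverse
    of \<open>A\<close>. Up to sign, \<open>p\<close> and \<open>r\<close> are the off-diagonal
    entries of this product and \<open>q\<close> is the difference of the diagonal ones, so it is
    scalar.\<close>
  define l where "l = ?a' * ?d - ?b' * ?c"
  have l': "l = ?d' * ?a - ?b * ?c'" using q unfolding q_def l_def by algebra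
  have "l * ?a = ?a' * (?a * ?d - ?b * ?c)" "l * ?b = ?b' * (?a * ?d - ?b * ?c)"
    using r unfolding r_def l_def by algebra+
  moreover have "l * ?c = ?c' * (?a * ?d - ?b * ?c)" "l * ?d = ?d' * (?a * ?d - ?b * ?c)"
    using p unfolding p_def l' by algebra+
  ultimately have B_eq: "?a' = l * ?a" "?b' = l * ?b" "?c' = l * ?c" "?d' = l * ?d"
    unfolding det mult_1_right by metis+
  moreover have "l = 1 \<or> l = - 1"
  proof -
    have "(l * l) * (?a * ?d - ?b * ?c) = ?a' * ?d' - ?b' * ?c'"
      unfolding B_eq by (simp add: algebra_simps)
    then have "l * l = 1" unfolding det det' by simp
    then show ?thesis by (simp add: square_eq_1_iff)
  qed
  moreover have "C = D" if "C $ 0 $ 0 = D $ 0 $ 0" "C $ 0 $ 1 = D $ 0 $ 1" "C $ 1 $ 0 = D $ 1 $ 0" "C $ 1 $ 1 = D $ 1 $ 1"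
    for C D :: "complex ^ 2 ^ 2"
    using that by (simp add: vec_eq_iff forall_2 bit_two)
  ultimately show ?thesis by auto
qed

text \<open>Recording the images of three roots maps the operators to a finite set, with fibres
  inside \<open>{A, - A}\<close>. Excluding infinity from the target roots makes all three images
  finite, as \<open>moebius_eq_cases\<close> requires.\<close>

lemma finite_root_operators:
  assumes "finite (roots E e i \<phi>)" "None \<notin> roots E e i \<phi>"
    and z: "z1 \<noteq> z2" "z1 \<noteq> z3" "z2 \<noteq> z3" "{Some z1, Some z2, Some z3} \<subseteq> roots E e i \<psi>"
  shows "finite (root_operators E e i \<psi> \<phi>)"
proof -
  let ?R = "roots E e i \<phi>" and ?O = "root_operators E e i \<psi> \<phi>"
  define h where "h A = (moebius A (Some z1), moebius A (Some z2), moebius A (Some z3))" for A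
  have h: "h A \<in> ?R \<times> ?R \<times> ?R" if "A \<in> ?O" for A
    using that z by (auto simp: root_operators_def h_def)
  have fib: "finite (h -` {y} \<inter> ?O)" if "y \<in> ?R \<times> ?R \<times> ?R" for y
  proof (cases "h -` {y} \<inter> ?O = {}")
    case False
    then obtain A where A: "A \<in> ?O" "h A = y" by auto
    have "B \<in> {A, - A}" if "B \<in> ?O" "h B = y" for B
    proof -
      have "\<exists>w. moebius A (Some z) = Some w \<and> moebius B (Some z) = Some w" if "z \<in> {z1, z2, z3}" for z
      proof -
        have "moebius A (Some z) = moebius B (Some z)" "moebius A (Some z) \<in> ?R"
          using that A \<open>h B = y\<close> h[OF A(1)] by (auto simp: h_def)
        then show ?thesis using assms(2) by (metis option.exhaust)
      qed
      moreover have "A \<in> SL2" "B \<in> SL2"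
        using A(1) \<open>B \<in> ?O\<close> by (simp_all add: root_operators_def)
      ultimately have "B = A \<or> B = - A"
        using moebius_eq_cases[OF _ _ z(1-3), of A B] by blast
      then show ?thesis by blast
    qed
    then have "h -` {y} \<inter> ?O \<subseteq> {A, - A}" by blast
    then show ?thesis by (rule finite_subset) simp
  qed simp
  have "finite (h -` (?R \<times> ?R \<times> ?R) \<inter> ?O)"
    by (rule finite_finite_vimage_IntI) (simp add: assms(1), rule fib)
  moreover have "?O \<subseteq> h -` (?R \<times> ?R \<times> ?R) \<inter> ?O" using h by auto
  ultimately show ?thesis by (rule finite_subset[rotated])
qed

section \<open>Zero sets of homogeneous polynomials\<close>

text \<open>Stands in for polynomials in several variables. Continuity makes the zero set closed,
  and a polynomial on a line has finitely many zeros unless it is zero.\<close>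

definition line_polynomial :: "(complex ^ 'a::finite \<Rightarrow> complex) \<Rightarrow> bool" where
  "line_polynomial F \<longleftrightarrow> continuous_on UNIV F \<and> (\<forall>u v. \<exists>p. \<forall>t. F (u + t *s v) = poly p t)"

lemma line_polynomial_const [intro, simp]: "line_polynomial (\<lambda>_. c)"
  by (auto simp: line_polynomial_def intro!: exI[of _ "[:c:]"])

lemma line_polynomial_coordinate [intro, simp]: "line_polynomial (\<lambda>v. v $ k)"
  unfolding line_polynomial_def
proof (intro conjI allI)
  fix u v :: "complex ^ 'a"
  show "\<exists>p. \<forall>t. (u + t *s v) $ k = poly p t"
    by (intro exI[of _ "[:u $ k, v $ k:]"]) simp
qed (intro continuous_intros)

lemma line_polynomial_add [intro]:
  assumes "line_polynomial F" "line_polynomial G"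
  shows "line_polynomial (\<lambda>v. F v + G v)"
  unfolding line_polynomial_def
proof (intro conjI allI)
  fix u v
  obtain p q where "\<forall>t. F (u + t *s v) = poly p t" "\<forall>t. G (u + t *s v) = poly q t"
    using assms by (meson line_polynomial_def)
  then show "\<exists>p. \<forall>t. F (u + t *s v) + G (u + t *s v) = poly p t"
    by (intro exI[of _ "p + q"]) simp
qed (use assms in \<open>auto simp: line_polynomial_def intro: continuous_intros\<close>)

lemma line_polynomial_mult [intro]:
  assumes "line_polynomial F" "line_polynomial G"
  shows "line_polynomial (\<lambda>v. F v * G v)"
  unfolding line_polynomial_def
proof (intro conjI allI)
  fix u v
  obtain p q where "\<forall>t. F (u + t *s v) = poly p t" "\<forall>t. G (u + t *s v) = poly q t"
    using assms by (meson line_polynomial_def)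
  then show "\<exists>p. \<forall>t. F (u + t *s v) * G (u + t *s v) = poly p t"
    by (intro exI[of _ "p * q"]) simp
qed (use assms in \<open>auto simp: line_polynomial_def intro: continuous_intros\<close>)

lemma line_polynomial_diff [intro]:
  assumes "line_polynomial F" "line_polynomial G"
  shows "line_polynomial (\<lambda>v. F v - G v)"
  using line_polynomial_add[OF assms(1) line_polynomial_mult[OF line_polynomial_const[of "- 1"] assms(2)]]
  by simp

lemma line_polynomial_power [intro]: "line_polynomial F \<Longrightarrow> line_polynomial (\<lambda>v. F v ^ k)"
  by (induction k) auto

lemma line_polynomial_sum:
  "(\<And>i. i \<in> I \<Longrightarrow> line_polynomial (F i)) \<Longrightarrow> line_polynomial (\<lambda>v. \<Sum>i\<in>I. F i v)"
  by (induction I rule: infinite_finite_induct) auto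

text \<open>
  If \<open>F\<close> vanished at all \<open>v + t d\<close>, then by homogeneity also at \<open>d + v / t\<close>, hence at \<open>d\<close>.
\<close>

lemma finite_zeros_on_line:
  fixes F :: "complex ^ 'a::finite \<Rightarrow> complex"
  assumes F: "line_polynomial F" and hom: "\<And>t v. F (t *s v) = t ^ D * F v" and d: "F d \<noteq> 0"
  shows "finite {t. F (v + t *s d) = 0}"
proof -
  obtain p where p: "\<And>t. F (v + t *s d) = poly p t"
    using F by (meson line_polynomial_def)
  obtain q where q: "\<And>t. F (d + t *s v) = poly q t"
    using F by (meson line_polynomial_def)
  have "p \<noteq> 0"
  proof
    assume "p = 0"
    have "poly q t = 0" if "t \<noteq> 0" for t
    proof -
      have "t *s (v + (1 / t) *s d) = d + t *s v"
        using that by (simp add: vec_eq_iff field_simps)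
      then show ?thesis using hom[of t "v + (1 / t) *s d"] p[of "1 / t"] q[of t] \<open>p = 0\<close>
        by (metis mult_zero_right poly_0)
    qed
    \<comment> \<open>Infinitely many zeros make \<open>q\<close> the zero polynomial, which extends
      its vanishing to 0, where its value is \<open>F d\<close>.\<close>
    then have "- {0} \<subseteq> {t. poly q t = 0}" by auto
    moreover have "infinite (- {0 :: complex})"
      by (simp add: infinite_UNIV_char_0 Compl_eq_Diff_UNIV)
    ultimately have "q = 0" using poly_roots_finite[of q] finite_subset by blast
    then show False using q[of 0] d by simp
  qed
  then show ?thesis using poly_roots_finite[of p] by (simp add: p)
qed

text \<open>
  Translating the zero set by \<open>t d\<close> does not change its measure. Averaging over \<open>t\<close> in the unit
  interval and exchanging the integrals reduces the claim to the finite intersections with lines.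
\<close>

lemma zero_set_null_lborel:
  fixes F :: "complex ^ 'a::finite \<Rightarrow> complex"
  assumes F: "line_polynomial F" and hom: "\<And>t v. F (t *s v) = t ^ D * F v" and d: "F d \<noteq> 0"
  shows "emeasure lborel {v. F v = 0} = 0"
proof -
  let ?Z = "{v. F v = 0}"
  have "closed ?Z"
    using F by (auto simp: line_polynomial_def intro: closed_Collect_eq)
  then have [measurable]: "?Z \<in> sets borel" by simp
  let ?I = "\<lambda>v t. indicator {0..1} t * indicator ?Z (v + t *\<^sub>R d) :: ennreal"
  have inner: "(\<integral>\<^sup>+t. ?I v t \<partial>lborel) = 0" for v
  proof -
    have "of_real t *s d = t *\<^sub>R d" for t :: real
      by (simp add: vec_eq_iff scaleR_conv_of_real[where 'a = complex])
    \<comment> \<open>The integral runs over real parameters; finiteness passes down from the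
      complex ones because the embedding is injective.\<close>
    then have "finite {t :: real. F (v + t *\<^sub>R d) = 0}"
      using finite_vimageI[OF finite_zeros_on_line[OF F hom d, of v] inj_of_real]
      by (simp add: vimage_def)
    then have null: "{t :: real. F (v + t *\<^sub>R d) = 0} \<in> null_sets lborel"
      by (rule finite_imp_null_set_lborel)
    have "(\<integral>\<^sup>+t. ?I v t \<partial>lborel) = (\<integral>\<^sup>+t. 0 \<partial>(lborel :: real measure))"
      by (rule nn_integral_cong_AE, rule AE_I'[OF null]) (auto simp: indicator_def)
    then show ?thesis by simp
  qed
  have "emeasure lborel ?Z = (\<integral>\<^sup>+t. indicator {0..1} t * emeasure lborel ?Z \<partial>(lborel :: real measure))"
    by (simp add: nn_integral_multc)
  also have "\<dots> = (\<integral>\<^sup>+t. \<integral>\<^sup>+v. ?I v t \<partial>lborel \<partial>lborel)"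
  proof (rule nn_integral_cong)
    fix t :: real
    have "(\<integral>\<^sup>+v. indicator ?Z (v + t *\<^sub>R d) \<partial>lborel) = emeasure lborel ?Z"
      using nn_integral_lborel_shift[of "indicator ?Z" "t *\<^sub>R d"] by simp
    then show "indicator {0..1} t * emeasure lborel ?Z = (\<integral>\<^sup>+v. ?I v t \<partial>lborel)"
      by (simp add: nn_integral_cmult)
  qed
  also have "\<dots> = (\<integral>\<^sup>+v. \<integral>\<^sup>+t. ?I v t \<partial>lborel \<partial>lborel)"
    by (rule lborel_pair.Fubini') measurable
  also have "\<dots> = 0" by (simp add: inner)
  finally show ?thesis .
qed

text \<open>By homogeneity the zero set is a cone, so pulling it back along the radial projection
  adds at most the origin.\<close>

lemma zero_set_null_fubini_study:
  fixes F :: "complex ^ 'a::finite \<Rightarrow> complex"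
  assumes F: "line_polynomial F" and hom: "\<And>t v. F (t *s v) = t ^ D * F v" and d: "F d \<noteq> 0"
  shows "{v. F v = 0} \<in> null_sets fubini_study"
proof -
  let ?Z = "{v. F v = 0}"
  have "closed ?Z"
    using F by (auto simp: line_polynomial_def intro: closed_Collect_eq)
  then have Z: "?Z \<in> sets borel" by simp
  have "F (sgn v) = complex_of_real (inverse (norm v)) ^ D * F v" for v
  proof -
    have "sgn v = complex_of_real (inverse (norm v)) *s v"
      by (simp add: vec_eq_iff sgn_div_norm scaleR_conv_of_real[where 'a = complex])
    then show ?thesis by (simp only: hom)
  qed
  then have "ball 0 1 \<inter> sgn -` ?Z \<subseteq> insert 0 ?Z"
    by (auto split: if_splits)
  then have "emeasure lborel (ball 0 1 \<inter> sgn -` ?Z) \<le> emeasure lborel (insert 0 ?Z)"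
    using Z by (intro emeasure_mono) auto
  also have "\<dots> \<le> emeasure lborel {0 :: complex ^ 'a} + emeasure lborel ?Z"
    using emeasure_subadditive[of "{0}" lborel ?Z] Z by simp
  also have "\<dots> = 0" using zero_set_null_lborel[OF F hom d] by simp
  finally show ?thesis
    using Z by (simp add: null_sets_def emeasure_fubini_study)
qed

section \<open>Generic pencils\<close>

text \<open>The leading coefficient times \<open>27\<close> times the discriminant of \<open>a x\<^sup>4 + b x\<^sup>3 + c x\<^sup>2 + d x + e\<close>.\<close>

definition quartic_disc :: "complex poly \<Rightarrow> complex" where
  "quartic_disc p =
     (let a = coeff p 4; b = coeff p 3; c = coeff p 2; d = coeff p 1; e = coeff p 0 in
      a * (4 * (12 * a * e - 3 * b * d + c\<^sup>2) ^ 3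
         - (72 * a * c * e + 9 * b * c * d - 27 * a * d\<^sup>2 - 27 * e * b\<^sup>2 - 2 * c ^ 3)\<^sup>2))"

lemma quartic_disc_smult: "quartic_disc (smult t p) = t ^ 7 * quartic_disc p"
  unfolding quartic_disc_def Let_def coeff_smult by algebra

lemma poly_degree_le_4:
  assumes "degree p \<le> 4"
  shows "p = [:coeff p 0, coeff p 1, coeff p 2, coeff p 3, coeff p 4:]"
proof (rule poly_eqI)
  fix n
  show "coeff p n = coeff [:coeff p 0, coeff p 1, coeff p 2, coeff p 3, coeff p 4:] n"
    using assms coeff_eq_0[of p n]
    by (auto simp: coeff_pCons numeral_eq_Suc split: nat.splits)
qed

text \<open>The discriminant excludes double roots and the leading factor forces degree 4; a
  squarefree complex polynomial has as many roots as its degree.\<close>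

lemma card_roots_quartic:
  assumes deg: "degree p \<le> 4" and disc: "quartic_disc p \<noteq> 0"
  shows "card {z. poly p z = 0} = 4"
proof -
  define a b c d e where "a = coeff p 4" and "b = coeff p 3" and "c = coeff p 2"
    and "d = coeff p 1" and "e = coeff p 0"
  have p: "p = [:e, d, c, b, a:]"
    unfolding a_def b_def c_def d_def e_def by (rule poly_degree_le_4[OF deg])
  have D: "a * (4 * (12 * a * e - 3 * b * d + c\<^sup>2) ^ 3
      - (72 * a * c * e + 9 * b * c * d - 27 * a * d\<^sup>2 - 27 * e * b\<^sup>2 - 2 * c ^ 3)\<^sup>2) \<noteq> 0"
    using disc unfolding quartic_disc_def Let_def a_def b_def c_def d_def e_def .
  have "rsquarefree p"
    unfolding rsquarefree_roots
  proof (intro allI notI)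
    fix r assume r: "poly p r = 0 \<and> poly (pderiv p) r = 0"
    \<comment> \<open>The two equations at a double root are solved for \<open>d\<close> and
      \<open>e\<close>.\<close>
    have d: "d = - (4 * a * r ^ 3 + 3 * b * r\<^sup>2 + 2 * c * r)"
      using r unfolding p by (simp add: pderiv_pCons) algebra
    have e: "e = 3 * a * r ^ 4 + 2 * b * r ^ 3 + c * r\<^sup>2"
      using r d unfolding p by simp algebra
    \<comment> \<open>At a double root \<open>r\<close> the two invariants of the quartic become \<open>K\<^sup>2\<close> and \<open>- 2 K\<^sup>3\<close>.\<close>
    define K where "K = 6 * a * r\<^sup>2 + 3 * b * r + c"
    have "12 * a * e - 3 * b * d + c\<^sup>2 = K\<^sup>2"
      unfolding d e K_def by algebra
    moreover have "72 * a * c * e + 9 * b * c * d - 27 * a * d\<^sup>2 - 27 * e * b\<^sup>2 - 2 * c ^ 3 = - 2 * K ^ 3"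
      unfolding d e K_def by algebra
    ultimately show False using D by (simp add: power_mult_distrib flip: power_mult)
  qed
  then have "smult (lead_coeff p) (\<Prod>z|poly p z = 0. [:-z, 1:]) = p"
    by (rule complex_poly_decompose_rsquarefree)
  moreover have "p \<noteq> 0" using disc by (auto simp: quartic_disc_def)
  moreover have "degree (\<Prod>z|poly p z = 0. [:-z, 1:]) = card {z. poly p z = 0}"
    by (subst degree_prod_eq_sum_degree) auto
  ultimately have "card {z. poly p z = 0} = degree p"
    by (metis degree_smult_eq leading_coeff_0_iff)
  also have "degree p = 4" using D unfolding p by simp
  finally show ?thesis .
qed

text \<open>The multilinear expansion of \<open>quartic P (t *s \<alpha> + \<beta>)\<close>.
  Explicit coefficients make visible that they depend polynomially on the state.\<close>

definition pencil :: "'m::finite set \<Rightarrow> 'm state \<Rightarrow> 'm state \<Rightarrow> complex poly" where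
  "pencil P \<alpha> \<beta> =
    (let f = quad_form P in
     [:f \<beta> \<beta> \<beta> \<beta>,
       f \<alpha> \<beta> \<beta> \<beta> + f \<beta> \<alpha> \<beta> \<beta> + f \<beta> \<beta> \<alpha> \<beta> + f \<beta> \<beta> \<beta> \<alpha>,
       f \<alpha> \<alpha> \<beta> \<beta> + f \<alpha> \<beta> \<alpha> \<beta> + f \<alpha> \<beta> \<beta> \<alpha> + f \<beta> \<alpha> \<alpha> \<beta> + f \<beta> \<alpha> \<beta> \<alpha> + f \<beta> \<beta> \<alpha> \<alpha>,
       f \<beta> \<alpha> \<alpha> \<alpha> + f \<alpha> \<beta> \<alpha> \<alpha> + f \<alpha> \<alpha> \<beta> \<alpha> + f \<alpha> \<alpha> \<alpha> \<beta>,
       f \<alpha> \<alpha> \<alpha> \<alpha>:])"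

lemma poly_pencil: "poly (pencil P \<alpha> \<beta>) t = quartic P (t *s \<alpha> + \<beta>)"
  by (simp add: pencil_def Let_def quartic_def quad_form_add quad_form_scale algebra_simps)

lemma degree_pencil: "degree (pencil P \<alpha> \<beta>) \<le> 4"
  by (simp add: pencil_def Let_def)

lemma coeff_4_pencil: "coeff (pencil P \<alpha> \<beta>) 4 = quartic P \<alpha>"
  by (simp add: pencil_def Let_def quartic_def numeral_eq_Suc)

lemma pencil_scale: "pencil P (t *s \<alpha>) (t *s \<beta>) = smult (t ^ 4) (pencil P \<alpha> \<beta>)"
  by (simp add: pencil_def Let_def quad_form_scale algebra_simps power4_eq_xxxx)

section \<open>Evaluation on sums of basis vectors\<close>

lemma weight_two_sites:
  assumes "p \<noteq> q" "\<And>i. i \<noteq> p \<Longrightarrow> i \<noteq> q \<Longrightarrow> eps (a i) (c i) * eps (b i) (d i) = 1"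
  shows "weight {p, q} a b c d = eps (a p) (b p) * eps (c p) (d p) * (eps (a q) (b q) * eps (c q) (d q))"
proof -
  have "weight {p, q} a b c d = (\<Prod>i\<in>UNIV. (if i = p then eps (a p) (b p) * eps (c p) (d p) else 1)
      * (if i = q then eps (a q) (b q) * eps (c q) (d q) else 1))"
    unfolding weight_def by (rule prod.cong) (use assms in \<open>auto simp: site_weight_def\<close>)
  then show ?thesis by (simp add: prod.distrib)
qed

lemma weight_eq_0:
  "i \<in> P \<Longrightarrow> a i = b i \<Longrightarrow> weight P a b c d = 0"
  "i \<in> P \<Longrightarrow> c i = d i \<Longrightarrow> weight P a b c d = 0"
  "i \<notin> P \<Longrightarrow> a i = c i \<Longrightarrow> weight P a b c d = 0"
  "i \<notin> P \<Longrightarrow> b i = d i \<Longrightarrow> weight P a b c d = 0"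
proof -
  have "site_weight (i \<in> P) (a i) (b i) (c i) (d i) = 0 \<Longrightarrow> weight P a b c d = 0"
    unfolding weight_def by (rule prod_zero) auto
  then show
    "i \<in> P \<Longrightarrow> a i = b i \<Longrightarrow> weight P a b c d = 0"
    "i \<in> P \<Longrightarrow> c i = d i \<Longrightarrow> weight P a b c d = 0"
    "i \<notin> P \<Longrightarrow> a i = c i \<Longrightarrow> weight P a b c d = 0"
    "i \<notin> P \<Longrightarrow> b i = d i \<Longrightarrow> weight P a b c d = 0"
    by (auto simp: site_weight_def)
qed

lemma quartic_supported:
  assumes "\<And>w. w \<notin> T \<Longrightarrow> \<psi> $ w = 0"
  shows "quartic P \<psi> = (\<Sum>a\<in>T. \<Sum>b\<in>T. \<Sum>c\<in>T. \<Sum>d\<in>T. weight P a b c d * (\<psi> $ a * \<psi> $ b * \<psi> $ c * \<psi> $ d))"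
proof -
  have "w \<in> T" if "\<psi> $ w \<noteq> 0" for w
    using assms that by blast
  then have "quartic P \<psi> = (\<Sum>(a, b, c, d)\<in>T \<times> T \<times> T \<times> T. weight P a b c d * (\<psi> $ a * \<psi> $ b * \<psi> $ c * \<psi> $ d))"
    unfolding quartic_def quad_form_def by (intro sum.mono_neutral_right) auto
  then show ?thesis by (simp add: sum.cartesian_product)
qed

context
  fixes p q :: "'m::finite" and X Y Z V :: "'m \<Rightarrow> 2"
  assumes pq: "p \<noteq> q"
  defines "X \<equiv> \<lambda>i. 0" and "Y \<equiv> \<lambda>i. if i = p \<or> i = q then 1 else 0"
    and "Z \<equiv> \<lambda>i. if i = p then 0 else 1" and "V \<equiv> \<lambda>i. if i = q then 0 else 1"
begin

text \<open>With two qubits no site carries the pairing \<open>(13)(24)\<close>. The four terms with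
  \<open>a \<noteq> b\<close> and \<open>c \<noteq> d\<close> all have weight 1, so nothing
  cancels.\<close>

lemma quartic_two_sites:
  assumes "\<And>i. i = p \<or> i = q"
  shows "quartic {p, q} (axis X 1 + axis Y 1) \<noteq> 0"
proof -
  have vals: "X p = 0" "X q = 0" "Y p = 1" "Y q = 1" by (simp_all add: X_def Y_def)
  then have ne: "X \<noteq> Y" by auto
  have w: "weight {p, q} a b c d = eps (a p) (b p) * eps (c p) (d p) * (eps (a q) (b q) * eps (c q) (d q))"
    for a b c d using assms pq by (intro weight_two_sites) auto
  show ?thesis
    by (subst quartic_supported[of "{X, Y}"]) (use ne ne[symmetric] in \<open>simp_all add: axis_def w vals\<close>)
qed

text \<open>\<open>X\<close> and \<open>Y\<close> are complementary at \<open>p\<close> and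
  \<open>q\<close>, and so are \<open>Z\<close> and \<open>V\<close>; at all other sites the first
  two are 0 and the last two are 1. The pairings thus force \<open>{a, b}\<close> and
  \<open>{c, d}\<close> to be these two pairs in some order, and the eight remaining terms all have
  weight -1.\<close>

lemma quartic_four_terms:
  assumes s: "s \<noteq> p" "s \<noteq> q"
  shows "quartic {p, q} (x *s axis X 1 + y *s axis Y 1 + z *s axis Z 1 + v *s axis V 1) = - 8 * x * y * z * v"
proof -
  have vals: "X p = 0" "X q = 0" "X s = 0" "Y p = 1" "Y q = 1" "Y s = 0"
    "Z p = 0" "Z q = 1" "Z s = 1" "V p = 1" "V q = 0" "V s = 1"
    using s pq by (auto simp: X_def Y_def Z_def V_def)
  then have ne: "X \<noteq> Y" "X \<noteq> Z" "X \<noteq> V" "Y \<noteq> Z" "Y \<noteq> V" "Z \<noteq> V" by auto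
  have w0: "weight {p, q} a b c d = 0"
    if "a p = b p \<or> a q = b q \<or> c p = d p \<or> c q = d q \<or> a s = c s \<or> b s = d s" for a b c d
    using that s weight_eq_0[of p "{p, q}"] weight_eq_0[of q "{p, q}"] weight_eq_0[of s "{p, q}"] by auto
  have w1: "weight {p, q} a b c d = - 1"
    if "(a, b, c, d) \<in> {(X, Y, Z, V), (X, Y, V, Z), (Y, X, Z, V), (Y, X, V, Z),
      (Z, V, X, Y), (Z, V, Y, X), (V, Z, X, Y), (V, Z, Y, X)}" for a b c d
    using that pq by (subst weight_two_sites[OF pq]) (auto simp: X_def Y_def Z_def V_def)
  show ?thesis
    by (subst quartic_supported[of "{X, Y, Z, V}"])
      (use ne ne[symmetric] in \<open>simp_all add: axis_def w0 w1 vals\<close>)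
qed

lemma quartic_disc_nonzero_example:
  assumes s: "s \<noteq> p" "s \<noteq> q"
  shows "\<exists>\<alpha> \<beta>. quartic_disc (pencil {p, q} \<alpha> \<beta>) \<noteq> 0"
proof (intro exI)
  \<comment> \<open>All coefficients of \<open>?\<alpha>\<close> are 1 and those of
    \<open>?\<beta>\<close> are the negated fourth roots of unity, so these become the four simple
    roots of the pencil.\<close>
  let ?\<alpha> = "axis X 1 + axis Y 1 + axis Z 1 + axis V (1 :: complex)"
  let ?\<beta> = "- axis X 1 + axis Y 1 - \<i> *s axis Z 1 + \<i> *s axis V 1"
  have "poly (pencil {p, q} ?\<alpha> ?\<beta>) t = poly [:8, 0, 0, 0, - 8:] t" for t
  proof -
    have "t *s ?\<alpha> + ?\<beta> = (t - 1) *s axis X 1 + (t + 1) *s axis Y 1 + (t - \<i>) *s axis Z 1 + (t + \<i>) *s axis V 1"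
      by (simp add: vec_eq_iff algebra_simps)
    then have "poly (pencil {p, q} ?\<alpha> ?\<beta>) t = - 8 * (t - 1) * (t + 1) * (t - \<i>) * (t + \<i>)"
      by (simp only: poly_pencil quartic_four_terms[OF s])
    also have "\<dots> = poly [:8, 0, 0, 0, - 8:] t"
      by (simp add: algebra_simps)
    finally show ?thesis .
  qed
  then have "pencil {p, q} ?\<alpha> ?\<beta> = [:8, 0, 0, 0, - 8:]"
    by (simp add: poly_eq_poly_eq_iff[symmetric] fun_eq_iff)
  then show "quartic_disc (pencil {p, q} ?\<alpha> ?\<beta>) \<noteq> 0"
    by (simp add: quartic_disc_def Let_def numeral_eq_Suc)
qed

end

section \<open>The exceptional set and the conclusion\<close>

lemma ex_components:
  fixes e :: "'n::finite \<Rightarrow> 'm::finite \<Rightarrow> 'n"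
  assumes "qubit_labelling e"
  obtains \<psi> where "component e i 0 \<psi> = \<alpha>" "component e i 1 \<psi> = \<beta>"
proof
  let ?\<psi> = "\<chi> w. (if w i = 0 then \<alpha> else \<beta>) $ (w \<circ> e i)"
  have restrict: "attach e i b x \<circ> e i = x" for b x
    using attach_other[OF assms] by (simp add: fun_eq_iff)
  show "component e i 0 ?\<psi> = \<alpha>" "component e i 1 ?\<psi> = \<beta>"
    by (simp_all add: vec_eq_iff component_nth restrict)
qed

definition component_disc :: "'m::finite set \<Rightarrow> ('n \<Rightarrow> 'm \<Rightarrow> 'n) \<Rightarrow> 'n \<Rightarrow> 'n::finite state \<Rightarrow> complex" where
  "component_disc P e i \<psi> = quartic_disc (pencil P (component e i 0 \<psi>) (component e i 1 \<psi>))"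

text \<open>The discriminant expression has degree 7 in the coefficients of the pencil, and these
  have degree 4 in the state.\<close>

lemma component_disc_scale: "component_disc P e i (t *s \<psi>) = t ^ 28 * component_disc P e i \<psi>"
  by (simp add: component_disc_def component_scale pencil_scale quartic_disc_smult flip: power_mult)

lemma line_polynomial_coeff_pCons:
  "line_polynomial F \<Longrightarrow> (\<And>k. line_polynomial (\<lambda>v. coeff (p v) k)) \<Longrightarrow>
    line_polynomial (\<lambda>v. coeff (pCons (F v) (p v)) k)"
  by (cases k) simp_all

lemma line_polynomial_component_disc: "line_polynomial (component_disc P e i)"
proof -
  have form: "line_polynomial (\<lambda>\<psi>. quad_form P (component e i a \<psi>) (component e i b \<psi>)
      (component e i c \<psi>) (component e i d \<psi>))" for a b c d
    unfolding quad_form_def split_def component_nth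
    by (intro line_polynomial_sum line_polynomial_mult line_polynomial_const line_polynomial_coordinate)
  have "line_polynomial (\<lambda>\<psi>. coeff (pencil P (component e i 0 \<psi>) (component e i 1 \<psi>)) k)" for k
    unfolding pencil_def Let_def
    by (intro line_polynomial_coeff_pCons line_polynomial_add form) simp
  then show ?thesis
    unfolding component_disc_def[abs_def] quartic_disc_def Let_def
    by (intro line_polynomial_mult line_polynomial_diff line_polynomial_add line_polynomial_power
        line_polynomial_const)
qed

lemma finite_root_operators_quartic:
  assumes \<psi>: "component_disc P e i \<psi> \<noteq> 0" and \<phi>: "component_disc P e i \<phi> \<noteq> 0"
  shows "finite (root_operators (quartic P) e i \<psi> \<phi>)"
proof -
  have roots: "roots (quartic P) e i \<xi> = Some ` {z. poly (pencil P (component e i 0 \<xi>) (component e i 1 \<xi>)) z = 0}"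
    and card: "card {z. poly (pencil P (component e i 0 \<xi>) (component e i 1 \<xi>)) z = 0} = 4"
    if "component_disc P e i \<xi> \<noteq> 0" for \<xi>
  proof -
    let ?p = "pencil P (component e i 0 \<xi>) (component e i 1 \<xi>)"
    have disc: "quartic_disc ?p \<noteq> 0" using that by (simp add: component_disc_def)
    then show "card {z. poly ?p z = 0} = 4" by (rule card_roots_quartic[OF degree_pencil])
    \<comment> \<open>The leading coefficient is a factor of \<open>quartic_disc\<close>; its being
      nonzero keeps infinity from being a root.\<close>
    have "coeff ?p 4 \<noteq> 0" using disc by (auto simp: quartic_disc_def)
    then show "roots (quartic P) e i \<xi> = Some ` {z. poly ?p z = 0}"
      by (auto simp: roots_def poly_pencil coeff_4_pencil)
  qed
  let ?R = "{z. poly (pencil P (component e i 0 \<psi>) (component e i 1 \<psi>)) z = 0}"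
  have "3 \<le> card ?R" using card[OF \<psi>] by simp
  then obtain T where "T \<subseteq> ?R" "card T = 3" by (meson obtain_subset_with_card_n)
  then obtain z1 z2 z3 where "z1 \<noteq> z2" "z1 \<noteq> z3" "z2 \<noteq> z3" "{z1, z2, z3} \<subseteq> ?R"
    by (auto simp: card_3_iff)
  moreover have "finite (roots (quartic P) e i \<phi>)"
    unfolding roots[OF \<phi>] using card[OF \<phi>] by (intro finite_imageI card_ge_0_finite) simp
  ultimately show ?thesis
    by (intro finite_root_operators[of "quartic P" e i \<phi> z1 z2 z3]) (auto simp: roots[OF \<psi>] roots[OF \<phi>])
qed

theorem proposition2:
  fixes e :: "'n::finite \<Rightarrow> 'm::finite \<Rightarrow> 'n"
  assumes "qubit_labelling e"
    and "3 \<le> CARD('n)"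
  shows "\<exists>h\<ge>3. \<exists>E :: 'm state \<Rightarrow> complex. slip_measure h E \<and>
    (\<exists>N \<in> null_sets fubini_study. \<forall>\<psi> \<in> pure_states - N. \<forall>\<phi> \<in> pure_states - N.
       (slocc_equivalent \<psi> \<phi> \<longleftrightarrow> root_criterion E e \<psi> \<phi>) \<and>
       (4 \<le> CARD('n) \<longrightarrow> (\<forall>i. finite (root_operators E e i \<psi> \<phi>))))"
proof -
  have "CARD('m) = card (UNIV - {i :: 'n})" for i
    using assms(1) bij_betw_same_card unfolding qubit_labelling_def by blast
  then have card: "Suc CARD('m) = CARD('n)"
    by (metis UNIV_I card.remove finite)
  then have "2 \<le> CARD('m)" using assms(2) by simp
  then obtain T :: "'m set" where "card T = 2" by (meson obtain_subset_with_card_n)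
  then obtain p q :: 'm where pq: "p \<noteq> q" by (auto simp: card_2_iff)
  let ?E = "quartic {p, q}"
  \<comment> \<open>This holds for all states, so the null set only has to secure
    finiteness.\<close>
  have iff: "slocc_equivalent \<psi> \<phi> \<longleftrightarrow> root_criterion ?E e \<psi> \<phi>" for \<psi> \<phi> :: "'n state"
    by (rule slocc_equivalent_iff_root_criterion[OF assms(1)]) (auto intro: quartic_local_op quartic_scale)
  have "slip_measure 4 ?E \<and> (\<exists>N \<in> null_sets fubini_study. \<forall>\<psi> \<in> pure_states - N. \<forall>\<phi> \<in> pure_states - N.
       4 \<le> CARD('n) \<longrightarrow> (\<forall>i. finite (root_operators ?E e i \<psi> \<phi>)))"
  \<comment> \<open>A third qubit \<open>s\<close> supplies the pencil with simple roots.\<close>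
  proof (cases "\<exists>s. s \<noteq> p \<and> s \<noteq> q")
    case True
    then obtain \<alpha> \<beta> where disc: "quartic_disc (pencil {p, q} \<alpha> \<beta>) \<noteq> 0"
      using quartic_disc_nonzero_example[OF pq] by blast
    then have "quartic {p, q} \<alpha> \<noteq> 0"
      by (auto simp: quartic_disc_def coeff_4_pencil)
    then have slip: "slip_measure 4 ?E" by (intro slip_measure_quartic) blast
    \<comment> \<open>Every qubit contributes its own discriminant locus, and there are finitely
      many qubits.\<close>
    let ?N = "\<Union>i. {\<psi>. component_disc {p, q} e i \<psi> = 0}"
    have "{\<psi>. component_disc {p, q} e i \<psi> = 0} \<in> null_sets fubini_study" for i
    proof -
      obtain \<psi> where "component e i 0 \<psi> = \<alpha>" "component e i 1 \<psi> = \<beta>"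
        by (rule ex_components[OF assms(1)])
      then have "component_disc {p, q} e i \<psi> \<noteq> 0" using disc by (simp add: component_disc_def)
      then show ?thesis
        by (rule zero_set_null_fubini_study[OF line_polynomial_component_disc component_disc_scale])
    qed
    then have "?N \<in> null_sets fubini_study" by (intro null_sets_UN') auto
    moreover have "finite (root_operators ?E e i \<psi> \<phi>)" if "\<psi> \<notin> ?N" "\<phi> \<notin> ?N" for i \<psi> \<phi>
      using that by (intro finite_root_operators_quartic) auto
    ultimately show ?thesis using slip by blast
  next
    case False
    then have two: "i = p \<or> i = q" for i by blast
    then have "UNIV = {p, q}" by auto
    then have "CARD('m) = 2" using pq by (metis card_2_iff)
    \<comment> \<open>For three qubits in total the finiteness claim is vacuous; only a nonzero
      measure on two qubits remains to be exhibited.\<close>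
    then have "\<not> 4 \<le> CARD('n)" using card by simp
    then show ?thesis
      using slip_measure_quartic quartic_two_sites[OF pq two] by blast
  qed
  then show ?thesis
    using iff by (intro exI[of _ 4] conjI exI[of _ ?E]) auto
qed

end
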